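(* Let $X=(x_j:0\le j\le N)$ be a partition of $[a,b]$. For each end condition type (I, II or III) there is $\alpha_0>0$ such that for every $\alpha\in(0,\alpha_0)$ and every data set $Y$ (real values $y_0,\dots,y_N$ together with the end data required by that type), there is exactly one $s_\alpha[Y]\in S_\alpha^2(X)$ and exactly one $t_\alpha[Y]\in T_\alpha^2(X)$ which takes the value $y_j$ at $x_j$ for all $0\le j\le N$ and satisfies the end condition of that type. Furthermore, for all $x\in[a,b]$, $$\lim_{\alpha\to0}s_\alpha[Y](x)=\sigma[Y](x)\quad\text{and}\quad\lim_{\alpha\to0}t_\alpha[Y](x)=\sigma[Y](x),$$ where $\sigma[Y]$ is the cubic spline interpolant of the data $Y$ with the same type of endpoint condition.
   Context: A partition of $[a,b]$ is a sequence $X=(x_j:0\le j\le N)$ with $a=x_0<x_1<\cdots<x_N=b$. For $\alpha>0$ (with $D=d/dx$), the second order polyhyperbolic splines are $$S_\alpha^2(X)=\{s\in C^2[a,b]:(D^2-\alpha^2)^2s=0\text{ on }[a,b]\setminus X\},$$ i.e. $C^2$ functions which on each $[x_{j-1},x_j]$ have the form $p(x)\cosh(\alpha x)+q(x)\sinh(\alpha x)$ with $p,q$ polynomials of degree at most $1$. Also $$T_\alpha^2(X)=\{\operatorname{sech}(\alpha\,\cdot)\,u:u\in S_\alpha^2(X)\},$$ i.e. $C^2$ functions which on each $[x_{j-1},x_j]$ have the form $p(x)+q(x)\tanh(\alpha x)$ with $p,q$ polynomials of degree at most $1$. End conditions for a function $u$ on $[a,b]$: Type I: $u'(a)=y_0'$,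 $u'(b)=y_N'$, for prescribed reals $y_0',y_N'$. Type II: $u''(a)=u''(b)=0$. Type III: $u''(a)=y_0''$, $u''(b)=y_N''$, for prescribed reals $y_0'',y_N''$. The cubic spline interpolant $\sigma[Y]$ with a given end condition is the unique $C^2$ function on $[a,b]$ that is a polynomial of degree at most $3$ on each $[x_{j-1},x_j]$, satisfies $\sigma[Y](x_j)=y_j$ for $0\le j\le N$, and satisfies that end condition. *)

theory Defs
  imports "HOL-Analysis.Analysis" "HOL-Computational_Algebra.Polynomial"
begin

definition interval_partition :: "real \<Rightarrow> real \<Rightarrow> nat \<Rightarrow> (nat \<Rightarrow> real) \<Rightarrow> bool" where
  "interval_partition a b N X \<longleftrightarrow>
     1 \<le> N \<and> X 0 = a \<and> X N = b \<and> (\<forall>j<N. X j < X (Suc j))"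

text \<open>Functions on the interval from \<open>a\<close> to \<open>b\<close> are represented by functions on the reals that
  are extensional on it, so that equality of functions is equality on the interval.
  Derivatives are taken within the interval: they are one-sided at \<open>a\<close> and \<open>b\<close>,
  and the usual two-sided ones in the interior.\<close>

definition ivl_deriv :: "real \<Rightarrow> real \<Rightarrow> (real \<Rightarrow> real) \<Rightarrow> real \<Rightarrow> real" where
  "ivl_deriv a b f x = vector_derivative f (at x within {a..b})"

definition C2_ivl :: "real \<Rightarrow> real \<Rightarrow> (real \<Rightarrow> real) set" where
  "C2_ivl a b = {f \<in> extensional {a..b}.
     f differentiable_on {a..b} \<and>
     ivl_deriv a b f differentiable_on {a..b} \<and>
     continuous_on {a..b} (ivl_deriv a b (ivl_deriv a b f))}"

definition hyp_op :: "real \<Rightarrow> real \<Rightarrow> real \<Rightarrow> (real \<Rightarrow> real) \<Rightarrow> real \<Rightarrow> real" where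
  "hyp_op a b \<alpha> u = (\<lambda>x. ivl_deriv a b (ivl_deriv a b u) x - \<alpha>\<^sup>2 * u x)"

text \<open>The equation \<open>(D\<^sup>2 - \<alpha>\<^sup>2)\<^sup>2 s = 0\<close> is understood classically: off the knots, \<open>s\<close> is
  four times differentiable. The end points are knots, so the set of remaining points is open.\<close>

definition polyhyp_splines ::
    "real \<Rightarrow> real \<Rightarrow> nat \<Rightarrow> (nat \<Rightarrow> real) \<Rightarrow> real \<Rightarrow> (real \<Rightarrow> real) set" where
  "polyhyp_splines a b N X \<alpha> = {s \<in> C2_ivl a b.
     \<forall>x \<in> {a..b} - X ` {0..N}.
       (\<forall>k<4. (ivl_deriv a b ^^ k) s differentiable (at x within {a..b})) \<and>
       (hyp_op a b \<alpha> ^^ 2) s x = 0}"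

definition sech :: "real \<Rightarrow> real" where
  "sech x = 1 / cosh x"

definition sech_splines ::
    "real \<Rightarrow> real \<Rightarrow> nat \<Rightarrow> (nat \<Rightarrow> real) \<Rightarrow> real \<Rightarrow> (real \<Rightarrow> real) set" where
  "sech_splines a b N X \<alpha> =
     (\<lambda>u. \<lambda>x\<in>{a..b}. sech (\<alpha> * x) * u x) ` polyhyp_splines a b N X \<alpha>"

definition cubic_splines ::
    "real \<Rightarrow> real \<Rightarrow> nat \<Rightarrow> (nat \<Rightarrow> real) \<Rightarrow> (real \<Rightarrow> real) set" where
  "cubic_splines a b N X = {s \<in> C2_ivl a b.
     \<forall>j\<in>{1..N}. \<exists>p :: real poly. degree p \<le> 3 \<and> (\<forall>x\<in>{X (j - 1)..X j}. s x = poly p x)}"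

datatype end_type = Type_I | Type_II | Type_III

text \<open>The reals \<open>c\<close> and \<open>d\<close> are the end data at \<open>a\<close> and \<open>b\<close>; Type II has no end data
  and ignores them.\<close>

fun end_condition ::
    "real \<Rightarrow> real \<Rightarrow> end_type \<Rightarrow> real \<Rightarrow> real \<Rightarrow> (real \<Rightarrow> real) \<Rightarrow> bool" where
  "end_condition a b Type_I c d u \<longleftrightarrow>
     ivl_deriv a b u a = c \<and> ivl_deriv a b u b = d"
| "end_condition a b Type_II c d u \<longleftrightarrow>
     ivl_deriv a b (ivl_deriv a b u) a = 0 \<and> ivl_deriv a b (ivl_deriv a b u) b = 0"
| "end_condition a b Type_III c d u \<longleftrightarrow>
     ivl_deriv a b (ivl_deriv a b u) a = c \<and> ivl_deriv a b (ivl_deriv a b u) b = d"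

definition interpolates ::
    "real \<Rightarrow> real \<Rightarrow> nat \<Rightarrow> (nat \<Rightarrow> real) \<Rightarrow> end_type \<Rightarrow>
     (nat \<Rightarrow> real) \<Rightarrow> real \<Rightarrow> real \<Rightarrow> (real \<Rightarrow> real) \<Rightarrow> bool" where
  "interpolates a b N X e y c d u \<longleftrightarrow>
     (\<forall>j\<le>N. u (X j) = y j) \<and> end_condition a b e c d u"

definition polyhyp_interpolant ::
    "real \<Rightarrow> real \<Rightarrow> nat \<Rightarrow> (nat \<Rightarrow> real) \<Rightarrow> end_type \<Rightarrow>
     (nat \<Rightarrow> real) \<Rightarrow> real \<Rightarrow> real \<Rightarrow> real \<Rightarrow> real \<Rightarrow> real" where
  "polyhyp_interpolant a b N X e y c d \<alpha> =
     (THE s. s \<in> polyhyp_splines a b N X \<alpha> \<and> interpolates a b N X e y c d s)"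

definition sech_interpolant ::
    "real \<Rightarrow> real \<Rightarrow> nat \<Rightarrow> (nat \<Rightarrow> real) \<Rightarrow> end_type \<Rightarrow>
     (nat \<Rightarrow> real) \<Rightarrow> real \<Rightarrow> real \<Rightarrow> real \<Rightarrow> real \<Rightarrow> real" where
  "sech_interpolant a b N X e y c d \<alpha> =
     (THE t. t \<in> sech_splines a b N X \<alpha> \<and> interpolates a b N X e y c d t)"

definition cubic_interpolant ::
    "real \<Rightarrow> real \<Rightarrow> nat \<Rightarrow> (nat \<Rightarrow> real) \<Rightarrow> end_type \<Rightarrow>
     (nat \<Rightarrow> real) \<Rightarrow> real \<Rightarrow> real \<Rightarrow> real \<Rightarrow> real" where
  "cubic_interpolant a b N X e y c d =
     (THE s. s \<in> cubic_splines a b N X \<and> interpolates a b N X e y c d s)"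

end

theory Submission
  imports Defs "HOL-Real_Asymp.Real_Asymp" "Jordan_Normal_Form.Determinant"
begin

text \<open>With the normalised solutions \<open>\<phi>\<^sub>k\<close> of \<open>(D\<^sup>2 - \<alpha>\<^sup>2)\<^sup>2 y = 0\<close>, which tend to \<open>t\<^sup>k / k!\<close> as
  \<open>\<alpha> \<rightarrow> 0\<close>, every polyhyperbolic spline is a combination of \<open>N + 3\<close> truncated basis functions,
  and for \<open>\<alpha> = 0\<close> the same basis spans the cubic splines. Interpolation thus becomes a square linear
  system whose matrix tends to the cubic one, also after multiplication by \<open>sech (\<alpha> x)\<close>. The cubic
  system has trivial kernel by an energy argument, so its determinant is nonzero, and Cramer's rule
  yields both solvability for small \<open>\<alpha>\<close> and convergence of the coefficients.\<close>

section \<open>Solutions of the differential equation\<close>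

text \<open>The obvious basis \<open>cosh (\<alpha> x)\<close>, \<open>sinh (\<alpha> x)\<close>,
  \<open>x cosh (\<alpha> x)\<close>, \<open>x sinh (\<alpha> x)\<close> collapses to 1, 0, x, 0 as
  \<alpha> tends to 0, so its interpolation matrix becomes singular in the limit. Normalising by the
  derivatives at a base point removes this obstacle: the functions stay independent, and \<alpha> =
  0 fits the same definitions, so that only one matrix, the cubic one, has to be shown invertible.
  The count N + 3 consists of 4 constants on the first segment and one for each further segment,
  because at a knot a C^2 spline can jump only in its third derivative. The bound
  \<open>\<alpha>\<^sub>0\<close> must not depend on the data; hence solvability is treated for all
  right-hand sides at once, through the inverse matrix. The factor \<open>sech (\<alpha> x)\<close>
  is handled as a weight that tends to 1 while its first two derivatives tend to 0. It leaves the
  coefficients alone and alters only the matrix entries, so both families share one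
  argument.\<close>

text \<open>The solution of \<open>(D\<^sup>2 - \<alpha>\<^sup>2)\<^sup>2 y = 0\<close> whose derivatives of orders \<open>0, ..., 3\<close> at \<open>0\<close>
  vanish except for the \<open>k\<close>-th, which is \<open>1\<close>. It is meant for \<open>k < 4\<close>.\<close>

definition phi :: "real \<Rightarrow> nat \<Rightarrow> real \<Rightarrow> real" where
  "phi \<alpha> k t =
     (if \<alpha> = 0 then t ^ k / fact k
      else if k = 0 then cosh (\<alpha> * t) - \<alpha> * t * sinh (\<alpha> * t) / 2
      else if k = 1 then (3 * sinh (\<alpha> * t) - \<alpha> * t * cosh (\<alpha> * t)) / (2 * \<alpha>)
      else if k = 2 then t * sinh (\<alpha> * t) / (2 * \<alpha>)
      else (\<alpha> * t * cosh (\<alpha> * t) - sinh (\<alpha> * t)) / (2 * \<alpha> ^ 3))"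

text \<open>The effect of differentiation on the initial data of a solution.\<close>

definition jet_shift :: "real \<Rightarrow> (nat \<Rightarrow> real) \<Rightarrow> nat \<Rightarrow> real" where
  "jet_shift \<alpha> z k = (if k < 3 then z (Suc k) else 2 * \<alpha>\<^sup>2 * z 2 - \<alpha> ^ 4 * z 0)"

definition hyp_sol :: "real \<Rightarrow> (nat \<Rightarrow> real) \<Rightarrow> real \<Rightarrow> real" where
  "hyp_sol \<alpha> z t = (\<Sum>k<4. z k * phi \<alpha> k t)"

lemma sum_lessThan_4: "(\<Sum>k<4. f k) = f 0 + f 1 + f 2 + f 3" for f :: "nat \<Rightarrow> real"
  by (simp add: eval_nat_numeral)

lemma less_4_cases: "k < 4 \<Longrightarrow> k = 0 \<or> k = 1 \<or> k = 2 \<or> k = (3::nat)"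
  by auto

lemma phi_at_0: "k < 4 \<Longrightarrow> phi \<alpha> k 0 = of_bool (k = 0)"
  by (auto simp: phi_def dest!: less_4_cases)

text \<open>The derivative of a solution is a solution, hence determined by its initial jet. The
  entries -\<alpha>^4 and 2 \<alpha>^2 are the fourth derivatives of \<open>phi \<alpha> 0\<close>
  and \<open>phi \<alpha> 2\<close> at 0, read off from y'''' = 2 \<alpha>^2 y'' - \<alpha>^4 y. One
  conjunction is proved so that the monomial case \<alpha> = 0 is split off only once.\<close>

lemma phi_derivs:
  "(phi \<alpha> 0 has_real_derivative - (\<alpha> ^ 4) * phi \<alpha> 3 t) (at t)"
  "(phi \<alpha> 1 has_real_derivative phi \<alpha> 0 t) (at t)"
  "(phi \<alpha> 2 has_real_derivative phi \<alpha> 1 t + 2 * \<alpha>\<^sup>2 * phi \<alpha> 3 t) (at t)"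
  "(phi \<alpha> 3 has_real_derivative phi \<alpha> 2 t) (at t)"
proof -
  have "(phi \<alpha> 0 has_real_derivative - (\<alpha> ^ 4) * phi \<alpha> 3 t) (at t) \<and>
    (phi \<alpha> 1 has_real_derivative phi \<alpha> 0 t) (at t) \<and>
    (phi \<alpha> 2 has_real_derivative phi \<alpha> 1 t + 2 * \<alpha>\<^sup>2 * phi \<alpha> 3 t) (at t) \<and>
    (phi \<alpha> 3 has_real_derivative phi \<alpha> 2 t) (at t)"
  proof (cases "\<alpha> = 0")
    case True
    then show ?thesis
      unfolding phi_def
      by (auto intro!: derivative_eq_intros simp: fact_numeral)
  next
    case False
    then show ?thesis
      unfolding phi_def
      by (auto intro!: derivative_eq_intros simp: divide_simps; simp add: algebra_simps power_numeral_reduce)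
  qed
  then show "(phi \<alpha> 0 has_real_derivative - (\<alpha> ^ 4) * phi \<alpha> 3 t) (at t)"
    "(phi \<alpha> 1 has_real_derivative phi \<alpha> 0 t) (at t)"
    "(phi \<alpha> 2 has_real_derivative phi \<alpha> 1 t + 2 * \<alpha>\<^sup>2 * phi \<alpha> 3 t) (at t)"
    "(phi \<alpha> 3 has_real_derivative phi \<alpha> 2 t) (at t)"
    by auto
qed

text \<open>For k > 0 the quotients have the form 0/0, and the leading terms of the expansions of
  \<open>cosh\<close> and \<open>sinh\<close> give t^k / k!. The expansions are taken for t > 0; at
  t = 0 the value does not depend on \<alpha>. Later t is the distance to a base point on the
  left.\<close>

lemma phi_tendsto:
  assumes "k < 4" "0 \<le> t"
  shows "((\<lambda>\<alpha>. phi \<alpha> k t) \<longlongrightarrow> phi 0 k t) (at_right 0)"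
proof (cases "t = 0")
  case True
  then show ?thesis using phi_at_0[OF assms(1)] by simp
next
  case False
  then have t: "t > 0" using assms by simp
  have ev: "eventually (\<lambda>\<alpha>::real. \<alpha> \<noteq> 0) (at_right 0)"
    using eventually_at_right_less[of "0::real"] by (rule eventually_mono) simp
  have 0: "((\<lambda>a. cosh (a * t) - a * t * sinh (a * t) / 2) \<longlongrightarrow> 1) (at_right 0)"
    using t by real_asymp
  have 1: "((\<lambda>a. (3 * sinh (a * t) - a * t * cosh (a * t)) / (2 * a)) \<longlongrightarrow> t) (at_right 0)"
    using t by real_asymp
  have 2: "((\<lambda>a. t * sinh (a * t) / (2 * a)) \<longlongrightarrow> t * t / 2) (at_right 0)"
    using t by real_asymp
  have 3: "((\<lambda>a. (a * t * cosh (a * t) - sinh (a * t)) / (2 * a ^ 3)) \<longlongrightarrow> t * (t * t) / 6) (at_right 0)"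
    using t by real_asymp
  show ?thesis
    using less_4_cases[OF assms(1)]
    apply (elim disjE)
    subgoal by (rule Lim_transform_eventually[rotated, OF eventually_mono[OF ev]]) (use 0 in \<open>auto simp: phi_def\<close>)
    subgoal by (rule Lim_transform_eventually[rotated, OF eventually_mono[OF ev]]) (use 1 in \<open>auto simp: phi_def\<close>)
    subgoal by (rule Lim_transform_eventually[rotated, OF eventually_mono[OF ev]]) (use 2 in \<open>auto simp: phi_def power2_eq_square\<close>)
    subgoal by (rule Lim_transform_eventually[rotated, OF eventually_mono[OF ev]]) (use 3 in \<open>auto simp: phi_def power3_eq_cube fact_numeral mult.assoc\<close>)
    done
qed

text \<open>Differentiation becomes a linear map on jets, so all derivatives of the basis functions
  are given by iterates of \<open>jet_shift\<close>.\<close>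

lemma hyp_sol_deriv: "(hyp_sol \<alpha> z has_real_derivative hyp_sol \<alpha> (jet_shift \<alpha> z) t) (at t)"
proof -
  have "((\<lambda>t. z 0 * phi \<alpha> 0 t + z 1 * phi \<alpha> 1 t + z 2 * phi \<alpha> 2 t + z 3 * phi \<alpha> 3 t)
     has_real_derivative (z 0 * (- (\<alpha> ^ 4) * phi \<alpha> 3 t) + z 1 * phi \<alpha> 0 t
       + z 2 * (phi \<alpha> 1 t + 2 * \<alpha>\<^sup>2 * phi \<alpha> 3 t) + z 3 * phi \<alpha> 2 t)) (at t)"
    by (intro DERIV_add DERIV_cmult phi_derivs)
  then show ?thesis
    by (simp add: hyp_sol_def[abs_def] sum_lessThan_4 jet_shift_def eval_nat_numeral algebra_simps)
qed

lemma hyp_sol_at_0: "hyp_sol \<alpha> z 0 = z 0"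
  by (simp add: hyp_sol_def sum_lessThan_4 phi_at_0)

text \<open>Together with \<open>hyp_sol_at_0\<close> this gives the m-th derivative at the base
  point as \<open>z m\<close>, which is the source of smoothness across the knots.\<close>

lemma jet_shift_funpow: "m + k < 4 \<Longrightarrow> (jet_shift \<alpha> ^^ m) z k = z (m + k)"
  by (induction m arbitrary: k) (auto simp: jet_shift_def)

text \<open>This is Cayley-Hamilton for the companion matrix of (D^2 - \<alpha>^2)^2.\<close>

lemma jet_shift_ode:
  "k < 4 \<Longrightarrow> (jet_shift \<alpha> ^^ 4) z k = 2 * \<alpha>\<^sup>2 * (jet_shift \<alpha> ^^ 2) z k - \<alpha> ^ 4 * z k"
  by (drule less_4_cases) (elim disjE; hypsubst; simp add: eval_nat_numeral jet_shift_def algebra_simps)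

lemma hyp_sol_ode:
  "hyp_sol \<alpha> ((jet_shift \<alpha> ^^ 4) z) t = 2 * \<alpha>\<^sup>2 * hyp_sol \<alpha> ((jet_shift \<alpha> ^^ 2) z) t - \<alpha> ^ 4 * hyp_sol \<alpha> z t"
  by (simp add: hyp_sol_def sum_distrib_left sum_subtractf[symmetric] algebra_simps jet_shift_ode)

text \<open>The coefficients may vary with \<alpha>, because the jets of derivatives are produced by
  \<open>jet_shift \<alpha>\<close>.\<close>

lemma hyp_sol_tendsto:
  assumes "0 \<le> t" "\<And>k. k < 4 \<Longrightarrow> ((\<lambda>\<alpha>. z \<alpha> k) \<longlongrightarrow> z 0 k) (at_right 0)"
  shows "((\<lambda>\<alpha>. hyp_sol \<alpha> (z \<alpha>) t) \<longlongrightarrow> hyp_sol 0 (z 0) t) (at_right 0)"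
  unfolding hyp_sol_def using assms
  by (intro tendsto_sum tendsto_mult phi_tendsto) auto

text \<open>The sum \<open>\<Sum>k<4. y k t * phi \<alpha> k (x - t)\<close> is constant in \<open>t\<close> along a solution, and at
  \<open>t = x\<close> it equals \<open>y 0 x\<close>.\<close>

lemma hyp_ode_unique:
  assumes S: "open S" "convex S" "c \<in> S" "x \<in> S"
    and d: "\<And>m t. m < 4 \<Longrightarrow> t \<in> S \<Longrightarrow> (y m has_real_derivative y (Suc m) t) (at t)"
    and ode: "\<And>t. t \<in> S \<Longrightarrow> y 4 t = 2 * \<alpha>\<^sup>2 * y 2 t - \<alpha> ^ 4 * y 0 t"
  shows "y 0 x = hyp_sol \<alpha> (\<lambda>k. y k c) (x - c)"
proof -
  define F where "F t = y 0 t * phi \<alpha> 0 (x - t) + y 1 t * phi \<alpha> 1 (x - t)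
     + y 2 t * phi \<alpha> 2 (x - t) + y 3 t * phi \<alpha> 3 (x - t)" for t
  have "(F has_real_derivative 0) (at t within S)" if t: "t \<in> S" for t
  proof -
    have D: "(y 0 has_real_derivative y 1 t) (at t)" "(y 1 has_real_derivative y 2 t) (at t)"
      "(y 2 has_real_derivative y 3 t) (at t)" "(y 3 has_real_derivative y 4 t) (at t)"
      using d[OF _ t, of 0] d[OF _ t, of 1] d[OF _ t, of 2] d[OF _ t, of 3]
      by (simp_all add: eval_nat_numeral)
    have R: "((\<lambda>t. f (x - t)) has_real_derivative - f') (at t)"
      if "(f has_real_derivative f') (at (x - t))" for f f'
      by (rule DERIV_cong[OF DERIV_chain2[where f=f and g="\<lambda>t. x - t" and Db="-1"]])
        (use that in \<open>auto intro!: derivative_eq_intros\<close>)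
    note P = phi_derivs[where \<alpha>=\<alpha> and t="x - t", THEN R]
    have "(F has_real_derivative
       y 0 t * (- (- (\<alpha> ^ 4) * phi \<alpha> 3 (x - t))) + y 1 t * phi \<alpha> 0 (x - t)
       + (y 1 t * (- phi \<alpha> 0 (x - t)) + y 2 t * phi \<alpha> 1 (x - t))
       + (y 2 t * (- (phi \<alpha> 1 (x - t) + 2 * \<alpha>\<^sup>2 * phi \<alpha> 3 (x - t))) + y 3 t * phi \<alpha> 2 (x - t))
       + (y 3 t * (- phi \<alpha> 2 (x - t)) + y 4 t * phi \<alpha> 3 (x - t))) (at t)"
      unfolding F_def
      by (rule DERIV_cong, (rule D P DERIV_mult' DERIV_add)+) (simp add: algebra_simps)
    also have "y 0 t * (- (- (\<alpha> ^ 4) * phi \<alpha> 3 (x - t))) + y 1 t * phi \<alpha> 0 (x - t)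
       + (y 1 t * (- phi \<alpha> 0 (x - t)) + y 2 t * phi \<alpha> 1 (x - t))
       + (y 2 t * (- (phi \<alpha> 1 (x - t) + 2 * \<alpha>\<^sup>2 * phi \<alpha> 3 (x - t))) + y 3 t * phi \<alpha> 2 (x - t))
       + (y 3 t * (- phi \<alpha> 2 (x - t)) + y 4 t * phi \<alpha> 3 (x - t)) = 0"
      unfolding ode[OF t] by (simp add: algebra_simps)
    finally show ?thesis by (rule has_field_derivative_at_within)
  qed
  then obtain C where C: "\<And>t. t \<in> S \<Longrightarrow> F t = C"
    using has_field_derivative_zero_constant[OF S(2)] by metis
  have "F x = y 0 x" by (simp add: F_def phi_at_0)
  moreover have "F c = hyp_sol \<alpha> (\<lambda>k. y k c) (x - c)"
    by (simp add: F_def hyp_sol_def sum_lessThan_4)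
  ultimately show ?thesis using C S by metis
qed

text \<open>Equality at order 0 propagates upwards by uniqueness of derivatives. This complements
  \<open>hyp_ode_unique\<close>, which identifies only \<open>y 0\<close>.\<close>

lemma iterated_derivs_unique:
  fixes f g :: "nat \<Rightarrow> real \<Rightarrow> real"
  assumes "open S" "\<And>x. x \<in> S \<Longrightarrow> f 0 x = g 0 x"
    and "\<And>m x. m < n \<Longrightarrow> x \<in> S \<Longrightarrow> (f m has_real_derivative f (Suc m) x) (at x)"
    and "\<And>m x. m < n \<Longrightarrow> x \<in> S \<Longrightarrow> (g m has_real_derivative g (Suc m) x) (at x)"
  shows "m \<le> n \<Longrightarrow> x \<in> S \<Longrightarrow> f m x = g m x"
proof (induction m arbitrary: x)
  case 0
  then show ?case using assms by simp
next
  case (Suc m)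
  have "(f m has_real_derivative g (Suc m) x) (at x)"
    by (rule has_field_derivative_transform_within_open[OF assms(4) assms(1)])
      (use Suc in auto)
  then show ?case using assms(3)[of m x] Suc DERIV_unique by auto
qed

text \<open>Nothing is known about \<open>y 3\<close> at the end points, so the initial value
  problem cannot be posed at \<open>p\<close> directly. It is solved from the midpoint, orders below
  3 are extended to the closed segment by continuity, and the resulting global solution is expanded
  again at \<open>p\<close>, where its jet is (0, 0, 0, D).\<close>

lemma hyp_ode_on_segment:
  assumes pq: "p < q"
    and d: "\<And>m t. m < 4 \<Longrightarrow> t \<in> {p<..<q} \<Longrightarrow> (y m has_real_derivative y (Suc m) t) (at t)"
    and ode: "\<And>t. t \<in> {p<..<q} \<Longrightarrow> y 4 t = 2 * \<alpha>\<^sup>2 * y 2 t - \<alpha> ^ 4 * y 0 t"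
    and cont: "\<And>m. m < 3 \<Longrightarrow> continuous_on {p..q} (y m)"
    and init: "\<And>m. m < 3 \<Longrightarrow> y m p = 0"
  shows "\<exists>D. \<forall>m<3. \<forall>x\<in>{p..q}.
    y m x = D * hyp_sol \<alpha> ((jet_shift \<alpha> ^^ m) (\<lambda>i. of_bool (i = 3))) (x - p)"
proof -
  define c where "c = (p + q) / 2"
  have c: "c \<in> {p<..<q}" using pq by (simp add: c_def)
  define g where "g m x = hyp_sol \<alpha> ((jet_shift \<alpha> ^^ m) (\<lambda>k. y k c)) (x - c)" for m x
  have sold: "((\<lambda>x. hyp_sol \<alpha> ((jet_shift \<alpha> ^^ m) z) (x - r)) has_real_derivative
      hyp_sol \<alpha> ((jet_shift \<alpha> ^^ Suc m) z) (x - r)) (at x)" for m z r x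
    using hyp_sol_deriv[of \<alpha> "(jet_shift \<alpha> ^^ m) z" "x + - r"]
    by (simp only: DERIV_shift funpow.simps comp_def) simp
  have gd: "(g m has_real_derivative g (Suc m) x) (at x)" for m x
    unfolding g_def by (rule sold)
  have yg: "y m x = g m x" if "m < 4" "x \<in> {p<..<q}" for m x
  proof (rule iterated_derivs_unique[where n=4 and S="{p<..<q}" and f=y and g=g])
    show "y 0 x = g 0 x" if "x \<in> {p<..<q}" for x
      using hyp_ode_unique[of "{p<..<q}" c x y \<alpha>] c that d ode by (simp add: g_def)
  qed (use that d gd in auto)
  have yg': "y m x = g m x" if "m < 3" "x \<in> {p..q}" for m x
  proof -
    have cl: "closure {p<..<q} = {p..q}" using pq by simp
    have "continuous_on (closure {p<..<q}) (\<lambda>x. y m x - g m x)"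
      unfolding cl using cont[OF that(1)]
      by (intro continuous_intros DERIV_continuous_on[OF has_field_derivative_at_within[OF gd]]) auto
    from continuous_constant_on_closure[OF this, of 0 x] have "y m x - g m x = 0"
      unfolding cl using yg[of m] that by auto
    then show ?thesis by simp
  qed
  \<comment> \<open>The constant is read off the continuation \<open>g\<close>, which is defined and
    smooth at \<open>p\<close>, and not off \<open>y 3\<close>.\<close>
  define D where "D = g 3 p"
  have gp: "g k p = D * of_bool (k = 3)" if "k < 4" for k
    using less_4_cases[OF that] yg'[of k p] init[of k] pq by (auto simp: D_def)
  define h where "h m x = D * hyp_sol \<alpha> ((jet_shift \<alpha> ^^ m) (\<lambda>i. of_bool (i = 3))) (x - p)" for m x
  have hd: "(h m has_real_derivative h (Suc m) x) (at x)" for m x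
    unfolding h_def by (rule DERIV_cmult[OF sold])
  have "g m x = h m x" if "m \<le> 4" for m x
  proof (rule iterated_derivs_unique[where n=4 and S=UNIV and f=g and g=h])
    show "g 0 x = h 0 x" for x
    proof -
      have "g 0 x = hyp_sol \<alpha> (\<lambda>k. g k p) (x - p)"
        by (rule hyp_ode_unique[where S=UNIV]) (use gd hyp_sol_ode in \<open>auto simp: g_def[abs_def]\<close>)
      also have "\<dots> = h 0 x"
        using gp by (simp add: hyp_sol_def h_def sum_lessThan_4)
      finally show ?thesis .
    qed
  qed (use gd hd that in auto)
  then have "\<forall>m<3. \<forall>x\<in>{p..q}. y m x = h m x" using yg' by auto
  then show ?thesis unfolding h_def by blast
qed

section \<open>Linear systems under perturbation\<close>

lemma tendsto_det:
  fixes A :: "'b \<Rightarrow> real mat"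
  assumes "\<And>x. A x \<in> carrier_mat n n" "L \<in> carrier_mat n n"
    and "\<And>i j. i < n \<Longrightarrow> j < n \<Longrightarrow> ((\<lambda>x. A x $$ (i, j)) \<longlongrightarrow> L $$ (i, j)) F"
  shows "((\<lambda>x. Determinant.det (A x)) \<longlongrightarrow> Determinant.det L) F"
  unfolding det_def'[OF assms(1)] det_def'[OF assms(2)]
  by (intro tendsto_sum tendsto_mult tendsto_const tendsto_prod assms(3)) (auto dest: permutes_in_image)

lemma tendsto_adj_mat:
  fixes A :: "'b \<Rightarrow> real mat"
  assumes "\<And>x. A x \<in> carrier_mat n n" "L \<in> carrier_mat n n"
    and "\<And>i j. i < n \<Longrightarrow> j < n \<Longrightarrow> ((\<lambda>x. A x $$ (i, j)) \<longlongrightarrow> L $$ (i, j)) F"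
    and ij: "i < n" "j < n"
  shows "((\<lambda>x. adj_mat (A x) $$ (i, j)) \<longlongrightarrow> adj_mat L $$ (i, j)) F"
proof -
  have dims: "dim_row (A x) = n" "dim_col (A x) = n" "dim_row L = n" "dim_col L = n" for x
    using assms(1,2) by auto
  have "((\<lambda>x. Determinant.det (mat_delete (A x) j i)) \<longlongrightarrow> Determinant.det (mat_delete L j i)) F"
  proof (rule tendsto_det)
    show "mat_delete (A x) j i \<in> carrier_mat (n - 1) (n - 1)" for x
      by (rule carrier_matI) (auto simp: mat_delete_def dims)
    show "mat_delete L j i \<in> carrier_mat (n - 1) (n - 1)"
      by (rule carrier_matI) (auto simp: mat_delete_def dims)
  qed (auto simp: mat_delete_def dims intro!: assms(3))
  then show ?thesis
    using ij by (simp add: adj_mat_def cofactor_def dims tendsto_mult)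
qed

text \<open>\<open>C x\<close> is the adjugate over the determinant, so its convergence follows from
  that of the entries. Injectivity is asked of the limit alone, since a nonzero limit determinant
  stays nonzero nearby. The quantifier over \<open>r\<close> stands inside the eventuality, which
  makes the neighbourhood independent of the data.\<close>

lemma linear_system_perturb:
  fixes A :: "'b \<Rightarrow> nat \<Rightarrow> nat \<Rightarrow> real"
  assumes lim: "\<And>i j. i < n \<Longrightarrow> j < n \<Longrightarrow> ((\<lambda>x. A x i j) \<longlongrightarrow> L i j) F"
    and inj: "\<And>z j. (\<And>i. i < n \<Longrightarrow> (\<Sum>j<n. L i j * z j) = 0) \<Longrightarrow> j < n \<Longrightarrow> z j = 0"
  obtains C C0 where
    "\<And>i j. i < n \<Longrightarrow> j < n \<Longrightarrow> ((\<lambda>x. C x i j) \<longlongrightarrow> C0 i j) F"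
    "\<forall>\<^sub>F x in F. \<forall>r z. (\<forall>i<n. (\<Sum>j<n. A x i j * z j) = r i) \<longleftrightarrow> (\<forall>j<n. z j = (\<Sum>i<n. C x j i * r i))"
    "\<forall>r z. (\<forall>i<n. (\<Sum>j<n. L i j * z j) = r i) \<longleftrightarrow> (\<forall>j<n. z j = (\<Sum>i<n. C0 j i * r i))"
proof -
  define M where "M B = Matrix.mat n n (\<lambda>(i, j). B i j)" for B :: "nat \<Rightarrow> nat \<Rightarrow> real"
  have M[simp]: "M B \<in> carrier_mat n n" for B by (simp add: M_def)
  define Inv where "Inv B j i = adj_mat (M B) $$ (j, i) / Determinant.det (M B)" for B j i
  have solve: "(\<forall>i<n. (\<Sum>j<n. B i j * z j) = r i) \<longleftrightarrow> (\<forall>j<n. z j = (\<Sum>i<n. Inv B j i * r i))"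
    if nz: "Determinant.det (M B) \<noteq> 0" for B z r
  proof -
    have entry: "(\<Sum>k<n. P $$ (i, k) * Q $$ (k, j)) = (P * Q) $$ (i, j)"
      if "P \<in> carrier_mat n n" "Q \<in> carrier_mat n n" "i < n" "j < n" for P Q :: "real mat" and i j
      using that by (simp add: scalar_prod_def atLeast0LessThan)
    have BI: "(\<Sum>k<n. B i k * Inv B k j) = of_bool (i = j)" if "i < n" "j < n" for i j
    proof -
      have "(\<Sum>k<n. B i k * Inv B k j) = (\<Sum>k<n. M B $$ (i, k) * adj_mat (M B) $$ (k, j)) / Determinant.det (M B)"
        unfolding sum_divide_distrib Inv_def by (rule sum.cong) (use that in \<open>auto simp: M_def\<close>)
      also have "\<dots> = of_bool (i = j)"
        using that nz adj_mat[OF M[of B]] by (simp add: entry)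
      finally show ?thesis .
    qed
    have IB: "(\<Sum>k<n. Inv B i k * B k j) = of_bool (i = j)" if "i < n" "j < n" for i j
    proof -
      have "(\<Sum>k<n. Inv B i k * B k j) = (\<Sum>k<n. adj_mat (M B) $$ (i, k) * M B $$ (k, j)) / Determinant.det (M B)"
        unfolding sum_divide_distrib Inv_def by (rule sum.cong) (use that in \<open>auto simp: M_def\<close>)
      also have "\<dots> = of_bool (i = j)"
        using that nz adj_mat[OF M[of B]] by (simp add: entry)
      finally show ?thesis .
    qed
    have assoc: "(\<Sum>j<n. P i j * (\<Sum>k<n. Q j k * w k)) = w i"
      if PQ: "\<And>k. k < n \<Longrightarrow> (\<Sum>j<n. P i j * Q j k) = of_bool (i = k)" and i: "i < n"
      for P Q :: "nat \<Rightarrow> nat \<Rightarrow> real" and w i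
    proof -
      have "(\<Sum>j<n. P i j * (\<Sum>k<n. Q j k * w k)) = (\<Sum>k<n. (\<Sum>j<n. P i j * Q j k) * w k)"
        unfolding sum_distrib_left sum_distrib_right by (subst sum.swap) (simp add: mult.assoc)
      also have "\<dots> = (\<Sum>k<n. if i = k then w k else 0)"
        by (rule sum.cong) (use PQ in auto)
      also have "\<dots> = w i" using i by simp
      finally show ?thesis .
    qed
    show ?thesis
    proof
      assume *: "\<forall>i<n. (\<Sum>j<n. B i j * z j) = r i"
      then have "(\<Sum>i<n. Inv B j i * r i) = (\<Sum>i<n. Inv B j i * (\<Sum>j<n. B i j * z j))" for j
        by (intro sum.cong) auto
      then show "\<forall>j<n. z j = (\<Sum>i<n. Inv B j i * r i)" using assoc IB by auto
    next
      assume *: "\<forall>j<n. z j = (\<Sum>i<n. Inv B j i * r i)"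
      then have "(\<Sum>j<n. B i j * z j) = (\<Sum>j<n. B i j * (\<Sum>i<n. Inv B j i * r i))" for i
        by (intro sum.cong) auto
      then show "\<forall>i<n. (\<Sum>j<n. B i j * z j) = r i" using assoc BI by auto
    qed
  qed
  have nz: "Determinant.det (M L) \<noteq> 0"
  proof
    assume "Determinant.det (M L) = 0"
    then obtain v where v: "v \<in> carrier_vec n" "v \<noteq> 0\<^sub>v n" "M L *\<^sub>v v = 0\<^sub>v n"
      using det_0_iff_vec_prod_zero_field[OF M] by blast
    have "(\<Sum>j<n. L i j * vec_index v j) = 0" if "i < n" for i
    proof -
      have "(\<Sum>j<n. L i j * vec_index v j) = vec_index (M L *\<^sub>v v) i"
        using that v(1) by (simp add: M_def scalar_prod_def atLeast0LessThan)
      then show ?thesis using v(3) that by simp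
    qed
    then have "vec_index v j = 0" if "j < n" for j
      using inj[of "vec_index v"] that by blast
    then have "v = 0\<^sub>v n" using v(1) by (intro eq_vecI) auto
    then show False using v(2) by simp
  qed
  have Mlim: "((\<lambda>x. M (A x) $$ (i, j)) \<longlongrightarrow> M L $$ (i, j)) F" if "i < n" "j < n" for i j
    using lim that by (simp add: M_def)
  have dlim: "((\<lambda>x. Determinant.det (M (A x))) \<longlongrightarrow> Determinant.det (M L)) F"
    by (rule tendsto_det[OF M M Mlim])
  have "\<forall>\<^sub>F x in F. Determinant.det (M (A x)) \<noteq> 0"
    by (rule tendsto_imp_eventually_ne[OF dlim nz])
  then have ev: "\<forall>\<^sub>F x in F. \<forall>r z. (\<forall>i<n. (\<Sum>j<n. A x i j * z j) = r i) \<longleftrightarrow>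
      (\<forall>j<n. z j = (\<Sum>i<n. Inv (A x) j i * r i))"
    by (rule eventually_mono) (use solve in blast)
  have "((\<lambda>x. Inv (A x) i j) \<longlongrightarrow> Inv L i j) F" if "i < n" "j < n" for i j
    unfolding Inv_def
    by (intro tendsto_divide dlim nz tendsto_adj_mat[OF M M Mlim that])
  then show ?thesis using that[OF _ ev] solve[OF nz] by blast
qed

section \<open>A basis of the polyhyperbolic splines\<close>

lemma funpow_2: "(f ^^ 2) x = f (f x)"
  by (simp add: numeral_2_eq_2)

text \<open>It holds at the end points as well: every point of a nondegenerate interval is a limit
  point of it, so the derivative within it is unique.\<close>

lemma ivl_deriv_cong:
  assumes "a < b" "x \<in> {a..b}" "\<And>x. x \<in> {a..b} \<Longrightarrow> f x = g x"
    and "(g has_real_derivative d) (at x within {a..b})"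
  shows "(f has_real_derivative d) (at x within {a..b})" "ivl_deriv a b f x = d"
proof -
  show f: "(f has_real_derivative d) (at x within {a..b})"
    by (rule has_field_derivative_transform_within[OF assms(4), of 1]) (use assms in auto)
  show "ivl_deriv a b f x = d"
    unfolding ivl_deriv_def
    by (rule vector_derivative_within_closed_interval)
      (use assms f in \<open>auto simp: has_real_derivative_iff_has_vector_derivative\<close>)
qed

lemma differentiable_ivl_deriv:
  assumes "f differentiable (at x within {a..b})"
  shows "(f has_real_derivative ivl_deriv a b f x) (at x within {a..b})"
  using assms unfolding ivl_deriv_def has_real_derivative_iff_has_vector_derivative
  by (simp add: vector_derivative_works)

text \<open>On an open subset the derivative within the interval is the two-sided one and depends
  only on local values. Hence a chain of derivatives known only on \<open>U\<close> determines the
  iterates there, whatever \<open>u\<close> does elsewhere.\<close>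

lemma ivl_deriv_iterate:
  assumes U: "open U" "U \<subseteq> {a..b}" and "a < b"
    and d: "\<And>m x. m < n \<Longrightarrow> x \<in> U \<Longrightarrow> (g m has_real_derivative g (Suc m) x) (at x)"
    and eq: "\<And>x. x \<in> U \<Longrightarrow> u x = g 0 x"
  shows "m \<le> n \<Longrightarrow> x \<in> U \<Longrightarrow> (ivl_deriv a b ^^ m) u x = g m x"
    and "m < n \<Longrightarrow> x \<in> U \<Longrightarrow>
      ((ivl_deriv a b ^^ m) u has_real_derivative g (Suc m) x) (at x within {a..b})"
proof -
  have step: "((ivl_deriv a b ^^ m) u has_real_derivative g (Suc m) x) (at x within {a..b})"
    if "\<And>x. x \<in> U \<Longrightarrow> (ivl_deriv a b ^^ m) u x = g m x" "m < n" "x \<in> U" for m x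
    by (rule has_field_derivative_at_within,
        rule has_field_derivative_transform_within_open[OF d U(1)]) (use that in auto)
  show *: "(ivl_deriv a b ^^ m) u x = g m x" if "m \<le> n" "x \<in> U" for m x
    using that
  proof (induction m arbitrary: x)
    case (Suc m)
    have "ivl_deriv a b ((ivl_deriv a b ^^ m) u) x = g (Suc m) x"
      by (rule ivl_deriv_cong(2)[OF \<open>a < b\<close> _ refl step]) (use Suc U in auto)
    then show ?case by simp
  qed (use eq in auto)
  show "((ivl_deriv a b ^^ m) u has_real_derivative g (Suc m) x) (at x within {a..b})"
    if "m < n" "x \<in> U"
    by (rule step) (use that * in auto)
qed

lemma hyp_op_sq_eq:
  assumes U: "open U" "U \<subseteq> {a..b}" and ab: "a < b"
    and d: "\<And>m x. m < 4 \<Longrightarrow> x \<in> U \<Longrightarrow> (g m has_real_derivative g (Suc m) x) (at x)"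
    and eq: "\<And>x. x \<in> U \<Longrightarrow> u x = g 0 x" and x: "x \<in> U"
  shows "\<forall>k<4. (ivl_deriv a b ^^ k) u differentiable (at x within {a..b})"
    and "(hyp_op a b \<alpha> ^^ 2) u x = g 4 x - 2 * \<alpha>\<^sup>2 * g 2 x + \<alpha> ^ 4 * g 0 x"
proof -
  have it: "(ivl_deriv a b ^^ m) u x = g m x" if "m \<le> 4" "x \<in> U" for m x
    by (rule ivl_deriv_iterate(1)[OF U ab, where n=4 and g=g]) (use d eq that in auto)
  have "((ivl_deriv a b ^^ m) u has_real_derivative g (Suc m) x) (at x within {a..b})" if "m < 4" for m
    by (rule ivl_deriv_iterate(2)[OF U ab, where n=4 and g=g]) (use d eq that x in auto)
  then show "\<forall>k<4. (ivl_deriv a b ^^ k) u differentiable (at x within {a..b})"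
    unfolding real_differentiable_def by blast
  \<comment> \<open>The inner application of the operator has its own chain of derivatives on
    \<open>U\<close>, so the outer one can be evaluated by the same iteration lemma.\<close>
  define h where "h m x = g (m + 2) x - \<alpha>\<^sup>2 * g m x" for m x
  have h: "hyp_op a b \<alpha> u x = h 0 x" if "x \<in> U" for x
    using it[OF _ that, of 2] eq[OF that] by (simp add: hyp_op_def h_def funpow_2) (simp add: numeral_2_eq_2)
  have hd: "(h m has_real_derivative h (Suc m) x) (at x)" if "m < 2" "x \<in> U" for m x
    unfolding h_def using d[of "m + 2" x] d[of m x] that
    by (auto intro!: derivative_eq_intros)
  have "(ivl_deriv a b ^^ 2) (hyp_op a b \<alpha> u) x = h 2 x"
    by (rule ivl_deriv_iterate(1)[OF U ab, where n=2 and g=h]) (use h hd x in auto)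
  then show "(hyp_op a b \<alpha> ^^ 2) u x = g 4 x - 2 * \<alpha>\<^sup>2 * g 2 x + \<alpha> ^ 4 * g 0 x"
    using h[OF x]
    by (simp add: funpow_2 hyp_op_def[of a b \<alpha> "hyp_op a b \<alpha> u"] h_def)
      (simp add: algebra_simps power2_eq_square power4_eq_xxxx flip: numeral_2_eq_2)
qed

lemma C2_ivl_derivs:
  assumes "u \<in> C2_ivl a b"
  shows "m < 2 \<Longrightarrow> x \<in> {a..b} \<Longrightarrow>
      ((ivl_deriv a b ^^ m) u has_real_derivative (ivl_deriv a b ^^ Suc m) u x) (at x within {a..b})"
    and "m < 3 \<Longrightarrow> continuous_on {a..b} ((ivl_deriv a b ^^ m) u)"
proof -
  show *: "((ivl_deriv a b ^^ m) u has_real_derivative (ivl_deriv a b ^^ Suc m) u x) (at x within {a..b})"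
    if "m < 2" "x \<in> {a..b}" for m x
  proof -
    have "m = 0 \<or> m = 1" using that by auto
    then show ?thesis
      using assms that unfolding C2_ivl_def differentiable_on_def
      by (auto intro!: differentiable_ivl_deriv)
  qed
  show "continuous_on {a..b} ((ivl_deriv a b ^^ m) u)" if "m < 3"
  proof (cases "m < 2")
    case True
    then show ?thesis using * by (intro DERIV_continuous_on) auto
  next
    case False
    then have "m = 2" using that by simp
    then show ?thesis using assms by (simp add: C2_ivl_def numeral_2_eq_2)
  qed
qed

lemma C2_ivlI:
  assumes ab: "a < b" and ext: "u \<in> extensional {a..b}"
    and eq: "\<And>x. x \<in> {a..b} \<Longrightarrow> u x = g 0 x"
    and d: "\<And>m x. m < 2 \<Longrightarrow> x \<in> {a..b} \<Longrightarrow> (g m has_real_derivative g (Suc m) x) (at x within {a..b})"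
    and c: "continuous_on {a..b} (g 2)"
  shows "u \<in> C2_ivl a b"
    and "x \<in> {a..b} \<Longrightarrow> ivl_deriv a b u x = g 1 x"
    and "x \<in> {a..b} \<Longrightarrow> ivl_deriv a b (ivl_deriv a b u) x = g 2 x"
proof -
  have d0: "(g 0 has_real_derivative g 1 x) (at x within {a..b})" if "x \<in> {a..b}" for x
    using d[of 0 x] that by simp
  have d1: "(g 1 has_real_derivative g 2 x) (at x within {a..b})" if "x \<in> {a..b}" for x
    using d[of 1 x] that by (simp add: numeral_2_eq_2)
  note 1 = ivl_deriv_cong[OF ab _ eq d0]
  note 2 = ivl_deriv_cong[OF ab _ 1(2) d1]
  show "ivl_deriv a b u x = g 1 x" if "x \<in> {a..b}" for x using 1(2) that by blast
  show **: "ivl_deriv a b (ivl_deriv a b u) x = g 2 x" if "x \<in> {a..b}" for x using 2(2) that by blast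
  have "continuous_on {a..b} (ivl_deriv a b (ivl_deriv a b u))"
    using c continuous_on_cong[OF refl **, of "{a..b}"] by auto
  then show "u \<in> C2_ivl a b"
    using ext 1(1) 2(1) unfolding C2_ivl_def differentiable_on_def real_differentiable_def by blast
qed

text \<open>At x = r the derivative from the left is 0 and the one from the right is f' 0 = 0, and
  the two half-lines are glued. The vanishing is demanded only when x = r, so higher orders away
  from the knot are covered too.\<close>

lemma truncated_deriv:
  assumes f: "\<And>t. (f has_real_derivative f' t) (at t)"
    and x: "x = r \<Longrightarrow> f 0 = 0 \<and> f' 0 = 0"
  shows "((\<lambda>x. if r \<le> x then f (x - r) else 0) has_real_derivative
          (if r \<le> x then f' (x - r) else 0)) (at x)"
proof -
  have s: "((\<lambda>x. f (x - r)) has_real_derivative f' (x - r)) (at x)" for x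
    using f[of "x + - r"] unfolding DERIV_shift by simp
  consider "x < r" | "x > r" | "x = r" by linarith
  then show ?thesis
  proof cases
    case 1
    have "((\<lambda>x. if r \<le> x then f (x - r) else 0) has_real_derivative 0) (at x)"
      by (rule has_field_derivative_transform_within_open[where S="{..<r}" and f="\<lambda>_. 0"])
        (use 1 in auto)
    then show ?thesis using 1 by simp
  next
    case 2
    have "((\<lambda>x. if r \<le> x then f (x - r) else 0) has_real_derivative f' (x - r)) (at x)"
      by (rule has_field_derivative_transform_within_open[where S="{r<..}", OF s]) (use 2 in auto)
    then show ?thesis using 2 by simp
  next
    case 3
    let ?h = "\<lambda>x. if r \<le> x then f (x - r) else 0"
    have "(?h has_real_derivative 0) (at r within {r..})"
      by (rule has_field_derivative_transform_within[where f="\<lambda>x. f (x - r)" and d=1])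
        (use s[of r] 3 x in \<open>auto intro: has_field_derivative_at_within\<close>)
    moreover have "(?h has_real_derivative 0) (at r within {..r})"
      by (rule has_field_derivative_transform_within[where f="\<lambda>x. 0" and d=1])
        (use 3 x in auto)
    ultimately have "(?h has_real_derivative 0) (at r within {..r} \<union> {r..})"
      unfolding has_field_derivative_iff Lim_within_Un by blast
    moreover have "{..r} \<union> {r..} = UNIV" by auto
    ultimately have "(?h has_real_derivative 0) (at r)" by simp
    then show ?thesis using 3 x by simp
  qed
qed

section \<open>Knots, segments and truncated basis functions\<close>

locale knots =
  fixes a b :: real and N :: nat and X :: "nat \<Rightarrow> real"
  assumes partition: "interval_partition a b N X"
begin

lemma X0: "X 0 = a" and XN: "X N = b" and N: "1 \<le> N"
  using partition by (auto simp: interval_partition_def)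

lemma X_less: "i < j \<Longrightarrow> j \<le> N \<Longrightarrow> X i < X j"
proof (induction j)
  case (Suc j)
  then have "X j < X (Suc j)" using partition by (auto simp: interval_partition_def)
  then show ?case using Suc by (cases "i = j") auto
qed simp

lemma X_le: "i \<le> j \<Longrightarrow> j \<le> N \<Longrightarrow> X i \<le> X j"
  using X_less[of i j] by (cases "i = j") auto

lemma ab: "a < b"
  using X_less[of 0 N] X0 XN N by simp

lemma X_mem: "i \<le> N \<Longrightarrow> X i \<in> {a..b}"
  using X_le[of 0 i] X_le[of i N] X0 XN by auto

lemma segment_cover: "j \<le> N \<Longrightarrow> x \<in> {a..X j} \<Longrightarrow> 0 < j \<Longrightarrow> \<exists>i<j. x \<in> {X i..X (Suc i)}"
proof (induction j)
  case (Suc j)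
  show ?case
  proof (cases "x \<le> X j \<and> 0 < j")
    case True
    then obtain i where "i < j" "x \<in> {X i..X (Suc i)}" using Suc by auto
    then show ?thesis by (intro exI[of _ i]) auto
  next
    case False
    then show ?thesis using Suc.prems X0 by (intro exI[of _ j]) (cases "j = 0"; simp)
  qed
qed simp

abbreviation off_knots :: "real set" where
  "off_knots \<equiv> {a..b} - X ` {0..N}"

lemma off_knots_cases:
  assumes "x \<in> off_knots"
  obtains i where "i < N" "x \<in> {X i<..<X (Suc i)}"
proof -
  obtain i where i: "i < N" "x \<in> {X i..X (Suc i)}"
    using segment_cover[of N x] assms XN N by auto
  moreover have "x \<noteq> X i" "x \<noteq> X (Suc i)" using assms i by auto
  ultimately show ?thesis using that[of i] by auto
qed

lemma segment_off_knots:
  assumes "i < N" "x \<in> {X i<..<X (Suc i)}"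
  shows "x \<in> off_knots"
proof -
  have "x \<noteq> X j" if "j \<le> N" for j
    using X_le[of j i] X_le[of "Suc i" j] assms that by (cases "j \<le> i") auto
  moreover have "x \<in> {a..b}" using X_mem[of i] X_mem[of "Suc i"] assms by auto
  ultimately show ?thesis by (auto simp: image_iff)
qed

text \<open>Both end points are knots. Removing the knots therefore leaves an open set, on which
  derivatives within the interval are ordinary ones.\<close>

lemma off_knots_eq: "off_knots = {a<..<b} - X ` {0..N}"
proof -
  have "a \<in> X ` {0..N}" "b \<in> X ` {0..N}"
    using imageI[of 0 "{0..N}" X] imageI[of N "{0..N}" X] X0 XN by simp_all
  then show ?thesis unfolding atLeastAtMost_diff_ends[symmetric] by blast
qed

lemma open_off_knots: "open off_knots"
  unfolding off_knots_eq by (intro open_Diff finite_imp_closed) auto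

text \<open>The \<open>m\<close>-th derivative of the \<open>k\<close>-th basis spline: three solutions based at \<open>a\<close>, then
  one truncated solution for each of the knots \<open>X 0, ..., X (N - 1)\<close>.\<close>

definition bas :: "real \<Rightarrow> nat \<Rightarrow> nat \<Rightarrow> real \<Rightarrow> real" where
  "bas \<alpha> k m x =
     (if k < 3 then hyp_sol \<alpha> ((jet_shift \<alpha> ^^ m) (\<lambda>i. of_bool (i = k))) (x - a)
      else if X (k - 3) \<le> x
      then hyp_sol \<alpha> ((jet_shift \<alpha> ^^ m) (\<lambda>i. of_bool (i = 3))) (x - X (k - 3)) else 0)"

text \<open>The truncated solution has jet (0, 0, 0, 1) at its knot, so orders m and m + 1 both
  vanish there when m < 2; off the knots every order is differentiable.\<close>

lemma bas_deriv:
  assumes "m < 2 \<or> x \<in> off_knots" "k < N + 3"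
  shows "(bas \<alpha> k m has_real_derivative bas \<alpha> k (Suc m) x) (at x)"
proof -
  have s: "(hyp_sol \<alpha> ((jet_shift \<alpha> ^^ m) z) has_real_derivative
      hyp_sol \<alpha> ((jet_shift \<alpha> ^^ Suc m) z) t) (at t)" for z t
    using hyp_sol_deriv[of \<alpha> "(jet_shift \<alpha> ^^ m) z" t] by simp
  show ?thesis
  proof (cases "k < 3")
    case True
    show ?thesis
      unfolding bas_def[abs_def] if_P[OF True]
      using s[of "\<lambda>i. of_bool (i = k)" "x + - a"] unfolding DERIV_shift by simp
  next
    case False
    have "x = X (k - 3) \<Longrightarrow> m < 2"
      using assms False by auto
    then show ?thesis
      unfolding bas_def[abs_def] if_not_P[OF False]
      by (intro truncated_deriv[OF s]) (simp del: funpow.simps add: hyp_sol_at_0 jet_shift_funpow)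
  qed
qed

lemma bas_continuous:
  assumes "m < 3" "k < N + 3"
  shows "continuous_on S (bas \<alpha> k m)"
proof (cases "k < 3")
  case True
  have c: "continuous_on UNIV (hyp_sol \<alpha> ((jet_shift \<alpha> ^^ m) (\<lambda>i. of_bool (i = k))))"
    using hyp_sol_deriv by (intro DERIV_continuous_on) (auto intro: has_field_derivative_at_within)
  show ?thesis
    unfolding bas_def[abs_def] if_P[OF True]
    by (auto intro!: continuous_intros continuous_on_compose2[OF c])
next
  case False
  let ?f = "hyp_sol \<alpha> ((jet_shift \<alpha> ^^ m) (\<lambda>i. of_bool (i = 3)))"
  have c: "continuous_on UNIV ?f"
    using hyp_sol_deriv by (intro DERIV_continuous_on) (auto intro: has_field_derivative_at_within)
  \<comment> \<open>For m = 2 the function has a corner at its knot. As \<open>?f\<close> vanishes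
    at 0, truncation amounts to clamping the argument, which is continuous.\<close>
  have "bas \<alpha> k m = (\<lambda>x. ?f (max 0 (x - X (k - 3))))"
    using False assms by (auto simp: bas_def fun_eq_iff max_def hyp_sol_at_0 jet_shift_funpow)
  then show ?thesis
    by (auto intro!: continuous_on_compose2[OF c] continuous_intros)
qed

lemma bas_ode: "bas \<alpha> k 4 x = 2 * \<alpha>\<^sup>2 * bas \<alpha> k 2 x - \<alpha> ^ 4 * bas \<alpha> k 0 x"
  unfolding bas_def using hyp_sol_ode by simp

text \<open>The knot itself is included. A new basis function thus leaves everything to its left
  unchanged, which drives the induction over the knots.\<close>

lemma bas_before_knot: "3 \<le> k \<Longrightarrow> x \<le> X (k - 3) \<Longrightarrow> m < 3 \<Longrightarrow> bas \<alpha> k m x = 0"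
  by (auto simp: bas_def hyp_sol_at_0 jet_shift_funpow)

lemma bas_at_left_end: "k < 3 \<Longrightarrow> m < 3 \<Longrightarrow> bas \<alpha> k m a = of_bool (k = m)"
  by (auto simp: bas_def hyp_sol_at_0 jet_shift_funpow)

lemma bas_tendsto:
  assumes "x \<in> {a..b}"
  shows "((\<lambda>\<alpha>. bas \<alpha> k m x) \<longlongrightarrow> bas 0 k m x) (at_right 0)"
proof -
  \<comment> \<open>The shifted jets are polynomials in \<alpha>, while the truncation test does not
    involve \<alpha>.\<close>
  have *: "((\<lambda>\<alpha>. (jet_shift \<alpha> ^^ m) z i) \<longlongrightarrow> (jet_shift 0 ^^ m) z i) (at_right 0)" for i m and z
  proof (induction m arbitrary: i)
    case (Suc m)
    show ?case
      unfolding funpow.simps comp_def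
      by (cases "i < 3") (auto simp: jet_shift_def intro!: tendsto_eq_intros Suc)
  qed simp
  show ?thesis
    unfolding bas_def using assms *
    by (auto intro!: hyp_sol_tendsto)
qed

section \<open>Splines as combinations of the basis\<close>

definition comb :: "real \<Rightarrow> (nat \<Rightarrow> real) \<Rightarrow> nat \<Rightarrow> real \<Rightarrow> real" where
  "comb \<alpha> z m x = (\<Sum>k<N + 3. z k * bas \<alpha> k m x)"

lemma comb_deriv:
  "m < 2 \<or> x \<in> off_knots \<Longrightarrow> (comb \<alpha> z m has_real_derivative comb \<alpha> z (Suc m) x) (at x)"
  unfolding comb_def[abs_def] by (intro DERIV_sum DERIV_cmult bas_deriv) auto

lemma comb_continuous: "m < 3 \<Longrightarrow> continuous_on S (comb \<alpha> z m)"
  unfolding comb_def[abs_def] by (intro continuous_intros bas_continuous) auto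

text \<open>A given spline is expanded knot by knot. Subtracting the combination valid up to
  \<open>X j\<close> leaves a solution on the next segment whose value and first two derivatives
  vanish at \<open>X j\<close>, hence a multiple of the truncated solution starting there. No sign
  condition on \<alpha> is imposed, so the cubic value 0 is included.\<close>

lemma polyhyp_splines_iff:
  "u \<in> polyhyp_splines a b N X \<alpha> \<longleftrightarrow> (\<exists>z. u = (\<lambda>x\<in>{a..b}. comb \<alpha> z 0 x))"
proof
  assume "\<exists>z. u = (\<lambda>x\<in>{a..b}. comb \<alpha> z 0 x)"
  then obtain z where u: "u = (\<lambda>x\<in>{a..b}. comb \<alpha> z 0 x)" by blast
  have "u \<in> C2_ivl a b"
  proof (rule C2_ivlI(1)[OF ab, where g="comb \<alpha> z"])
    show "(comb \<alpha> z m has_real_derivative comb \<alpha> z (Suc m) x) (at x within {a..b})"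
      if "m < 2" for m x
      by (rule has_field_derivative_at_within, rule comb_deriv) (use that in blast)
  qed (auto simp: u intro!: comb_continuous)
  moreover have "(\<forall>k<4. (ivl_deriv a b ^^ k) u differentiable (at x within {a..b})) \<and>
       (hyp_op a b \<alpha> ^^ 2) u x = 0" if x: "x \<in> off_knots" for x
  proof -
    have ode: "comb \<alpha> z 4 x = 2 * \<alpha>\<^sup>2 * comb \<alpha> z 2 x - \<alpha> ^ 4 * comb \<alpha> z 0 x"
      unfolding comb_def sum_distrib_left sum_subtractf[symmetric] bas_ode
      by (rule sum.cong) (simp_all add: algebra_simps)
    have sub: "off_knots \<subseteq> {a..b}" by blast
    have eq: "u x = comb \<alpha> z 0 x" if "x \<in> off_knots" for x
      unfolding u using that by simp
    have d: "(comb \<alpha> z m has_real_derivative comb \<alpha> z (Suc m) x) (at x)" if "x \<in> off_knots" for m x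
      using comb_deriv that by blast
    note H = hyp_op_sq_eq[OF open_off_knots sub ab, where g="comb \<alpha> z" and u=u]
    have "\<forall>k<4. (ivl_deriv a b ^^ k) u differentiable (at x within {a..b})"
      by (rule H(1)[OF d eq x])
    moreover have "(hyp_op a b \<alpha> ^^ 2) u x =
        comb \<alpha> z 4 x - 2 * \<alpha>\<^sup>2 * comb \<alpha> z 2 x + \<alpha> ^ 4 * comb \<alpha> z 0 x"
      by (rule H(2)[OF d eq x])
    ultimately show ?thesis unfolding ode by simp
  qed
  ultimately show "u \<in> polyhyp_splines a b N X \<alpha>"
    unfolding polyhyp_splines_def by blast
next
  assume u: "u \<in> polyhyp_splines a b N X \<alpha>"
  define D where "D m = (ivl_deriv a b ^^ m) u" for m
  have C2: "u \<in> C2_ivl a b" using u by (auto simp: polyhyp_splines_def)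
  have Dcont: "continuous_on {a..b} (D m)" if "m < 3" for m
    unfolding D_def by (rule C2_ivl_derivs(2)[OF C2 that])
  have Dd: "(D m has_real_derivative D (Suc m) x) (at x)" if "m < 4" "x \<in> off_knots" for m x
  proof -
    have "D m differentiable (at x within {a..b})"
      using u that unfolding polyhyp_splines_def D_def by blast
    from differentiable_ivl_deriv[OF this] show ?thesis
      using that(2) unfolding off_knots_eq by (simp add: D_def at_within_Icc_at)
  qed
  have Dode: "D 4 x = 2 * \<alpha>\<^sup>2 * D 2 x - \<alpha> ^ 4 * D 0 x" if x: "x \<in> off_knots" for x
  proof -
    have sub: "off_knots \<subseteq> {a..b}" by blast
    have "(hyp_op a b \<alpha> ^^ 2) u x = D 4 x - 2 * \<alpha>\<^sup>2 * D 2 x + \<alpha> ^ 4 * D 0 x"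
      by (rule hyp_op_sq_eq(2)[OF open_off_knots sub ab, where g=D]) (use Dd x in \<open>simp_all add: D_def\<close>)
    moreover have "(hyp_op a b \<alpha> ^^ 2) u x = 0"
      using u x unfolding polyhyp_splines_def by blast
    ultimately show ?thesis by simp
  qed
  \<comment> \<open>All three orders are carried along, since they are the initial data for the next
    segment.\<close>
  have "j \<le> N \<Longrightarrow> \<exists>z. \<forall>m<3. \<forall>x\<in>{a..X j}. D m x = (\<Sum>k<j + 3. z k * bas \<alpha> k m x)" for j
  proof (induction j)
    case 0
    \<comment> \<open>The range is the single point \<open>a\<close>, so the base case only has to
      match the jet of \<open>u\<close> there.\<close>
    have "D m x = (\<Sum>k<0 + 3. D k a * bas \<alpha> k m x)" if "m < 3" "x \<in> {a..X 0}" for m x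
    proof -
      have "x = a" using that X0 by simp
      then have "D k a * bas \<alpha> k m x = (if k = m then D m x else 0)" if "k < 3" for k
        using bas_at_left_end[OF that \<open>m < 3\<close>] by simp
      then have "(\<Sum>k<0 + 3. D k a * bas \<alpha> k m x) = (\<Sum>k<3. if k = m then D m x else 0)"
        by (intro sum.cong) simp_all
      also have "\<dots> = D m x" using that(1) by (simp add: sum.delta)
      finally show ?thesis by simp
    qed
    then show ?case by (intro exI[of _ "\<lambda>k. D k a"] allI impI ballI)
  next
    case (Suc j)
    then have "j \<le> N" by simp
    from Suc.IH[OF this] obtain z
      where "\<forall>m<3. \<forall>x\<in>{a..X j}. D m x = (\<Sum>k<j + 3. z k * bas \<alpha> k m x)"
      by blast
    then have z: "\<And>m x. m < 3 \<Longrightarrow> x \<in> {a..X j} \<Longrightarrow> D m x = (\<Sum>k<j + 3. z k * bas \<alpha> k m x)"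
      by blast
    define R where "R m x = D m x - (\<Sum>k<j + 3. z k * bas \<alpha> k m x)" for m x
    have sub: "{X j..X (Suc j)} \<subseteq> {a..b}"
      using X_mem[of j] X_mem[of "Suc j"] Suc.prems by simp
    have off: "x \<in> off_knots" if "x \<in> {X j<..<X (Suc j)}" for x
      using segment_off_knots[of j x] that Suc.prems by simp
    have "\<exists>E. \<forall>m<3. \<forall>x\<in>{X j..X (Suc j)}.
      R m x = E * hyp_sol \<alpha> ((jet_shift \<alpha> ^^ m) (\<lambda>i. of_bool (i = 3))) (x - X j)"
    proof (rule hyp_ode_on_segment)
      show "X j < X (Suc j)" using X_less[of j "Suc j"] Suc.prems by simp
      show "(R m has_real_derivative R (Suc m) t) (at t)" if "m < 4" "t \<in> {X j<..<X (Suc j)}" for m t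
        unfolding R_def
        by (intro DERIV_diff DERIV_sum DERIV_cmult bas_deriv Dd) (use that off[OF that(2)] Suc.prems in simp_all)
      show "R 4 t = 2 * \<alpha>\<^sup>2 * R 2 t - \<alpha> ^ 4 * R 0 t" if "t \<in> {X j<..<X (Suc j)}" for t
        unfolding R_def bas_ode using Dode[OF off[OF that]]
        by (simp add: sum_distrib_left sum_subtractf algebra_simps)
      show "continuous_on {X j..X (Suc j)} (R m)" if "m < 3" for m
        unfolding R_def
        by (intro continuous_on_diff continuous_on_sum continuous_on_mult continuous_on_const
            bas_continuous continuous_on_subset[OF Dcont sub])
          (use that Suc.prems in simp_all)
      show "R m (X j) = 0" if "m < 3" for m
        using z[OF that, of "X j"] X_mem[of j] Suc.prems by (simp add: R_def)
    qed
    then obtain E where E: "\<And>m x. m < 3 \<Longrightarrow> x \<in> {X j..X (Suc j)} \<Longrightarrow>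
      R m x = E * hyp_sol \<alpha> ((jet_shift \<alpha> ^^ m) (\<lambda>i. of_bool (i = 3))) (x - X j)"
      by blast
    define z' where "z' = z(j + 3 := E)"
    have "D m x = (\<Sum>k<Suc j + 3. z' k * bas \<alpha> k m x)" if "m < 3" "x \<in> {a..X (Suc j)}" for m x
    proof -
      have "(\<Sum>k<Suc j + 3. z' k * bas \<alpha> k m x) = (\<Sum>k<j + 3. z k * bas \<alpha> k m x) + E * bas \<alpha> (j + 3) m x"
        unfolding add_Suc sum.lessThan_Suc by (simp add: z'_def)
      also have "\<dots> = D m x"
      proof (cases "x \<le> X j")
        case True
        then show ?thesis using z[of m x] that bas_before_knot[of "j + 3" x m] by simp
      next
        case False
        then show ?thesis using E[of m x] that by (simp add: R_def bas_def)
      qed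
      finally show ?thesis by simp
    qed
    then show ?case by (intro exI[of _ z'] allI impI ballI)
  qed
  from this[of N] obtain z where "\<forall>m<3. \<forall>x\<in>{a..b}. D m x = comb \<alpha> z m x"
    unfolding comb_def XN by blast
  then have z: "D 0 x = comb \<alpha> z 0 x" if "x \<in> {a..b}" for x
    using that zero_less_numeral by blast
  have "u \<in> extensional {a..b}" using C2 unfolding C2_ivl_def by blast
  then have "u = (\<lambda>x\<in>{a..b}. comb \<alpha> z 0 x)"
    by (rule extensionalityI[OF _ restrict_extensional]) (use z in \<open>simp add: D_def\<close>)
  then show "\<exists>z. u = (\<lambda>x\<in>{a..b}. comb \<alpha> z 0 x)" by blast
qed

end

section \<open>The cubic case\<close>

lemma hyp_sol_unit: "k < 4 \<Longrightarrow> hyp_sol \<alpha> (\<lambda>i. of_bool (i = k)) t = phi \<alpha> k t"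
  by (drule less_4_cases) (auto simp: hyp_sol_def sum_lessThan_4)

context knots
begin

lemma bas_0_poly:
  assumes "k < N + 3" "i < N"
  shows "\<exists>p. degree p \<le> 3 \<and> (\<forall>x\<in>{X i..X (Suc i)}. bas 0 k 0 x = poly p x)"
proof -
  have deg: "degree (Polynomial.smult c ([:- r, 1:] ^ n)) \<le> 3" if "n \<le> 3" for c r :: real and n
    using degree_smult_le[of c "[:- r, 1:] ^ n"] degree_linear_power[of "- r" n] that by linarith
  consider "k < 3" | "3 \<le> k" "k - 3 \<le> i" | "3 \<le> k" "Suc i \<le> k - 3" by linarith
  then show ?thesis
  proof cases
    case 1
    then have "bas 0 k 0 x = poly (Polynomial.smult (1 / fact k) ([:- a, 1:] ^ k)) x" for x
      by (simp add: bas_def hyp_sol_unit phi_def poly_power)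
    moreover have "degree (Polynomial.smult (1 / fact k) ([:- a, 1:] ^ k)) \<le> 3"
      by (rule deg) (use 1 in simp)
    ultimately show ?thesis
      by (intro exI[of _ "Polynomial.smult (1 / fact k) ([:- a, 1:] ^ k)"] conjI ballI)
  next
    case 2
    have "X (k - 3) \<le> X i" using X_le[of "k - 3" i] 2 assms by simp
    then have "bas 0 k 0 x = poly (Polynomial.smult (1 / fact 3) ([:- X (k - 3), 1:] ^ 3)) x" if "X i \<le> x" for x
      using 2 that by (simp add: bas_def hyp_sol_unit phi_def poly_power)
    moreover have "degree (Polynomial.smult (1 / fact 3) ([:- X (k - 3), 1:] ^ 3)) \<le> 3"
      by (rule deg) simp
    ultimately show ?thesis
      by (intro exI[of _ "Polynomial.smult (1 / fact 3) ([:- X (k - 3), 1:] ^ 3)"] conjI ballI) simp_all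
  next
    case 3
    have "X (Suc i) \<le> X (k - 3)" using X_le[of "Suc i" "k - 3"] 3 assms by simp
    then have "bas 0 k 0 x = poly 0 x" if "x \<le> X (Suc i)" for x
      using bas_before_knot[of k x 0 0] 3 that by simp
    then show ?thesis by (intro exI[of _ 0]) simp
  qed
qed

text \<open>At \<alpha> = 0 the equation reads s'''' = 0. The converse inclusion needs no
  integration: the basis functions are already known to be piecewise cubic.\<close>

lemma cubic_splines_eq: "cubic_splines a b N X = polyhyp_splines a b N X 0"
proof (intro Set.set_eqI iffI)
  fix s assume s: "s \<in> cubic_splines a b N X"
  have "(\<forall>k<4. (ivl_deriv a b ^^ k) s differentiable (at x within {a..b})) \<and>
      (hyp_op a b 0 ^^ 2) s x = 0" if x: "x \<in> off_knots" for x
  proof -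
    obtain i where i: "i < N" "x \<in> {X i<..<X (Suc i)}" using off_knots_cases[OF x] .
    have "Suc i \<in> {1..N}" using i by simp
    then obtain p where "degree p \<le> 3 \<and> (\<forall>x\<in>{X (Suc i - 1)..X (Suc i)}. s x = poly p x)"
      using s unfolding cubic_splines_def by blast
    then have p: "degree p \<le> 3" "\<And>x. x \<in> {X i..X (Suc i)} \<Longrightarrow> s x = poly p x" by auto
    define g where "g m = poly ((pderiv ^^ m) p)" for m
    have U: "open {X i<..<X (Suc i)}" "{X i<..<X (Suc i)} \<subseteq> {a..b}"
      using X_mem[of i] X_mem[of "Suc i"] i by (auto intro: open_greaterThanLessThan)
    have d: "(g m has_real_derivative g (Suc m) x) (at x)" for m x
      unfolding g_def by (simp add: poly_DERIV)
    have eq: "s x = g 0 x" if "x \<in> {X i<..<X (Suc i)}" for x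
      using p(2)[of x] that by (simp add: g_def)
    have "degree (pderiv (pderiv (pderiv p))) = 0" using p(1) by (simp add: degree_pderiv)
    then have "pderiv (pderiv (pderiv (pderiv p))) = 0" unfolding pderiv_eq_0_iff .
    then have g4: "g 4 x = 0" by (simp add: g_def eval_nat_numeral)
    note H = hyp_op_sq_eq[OF U ab, where g=g and u=s]
    have "\<forall>k<4. (ivl_deriv a b ^^ k) s differentiable (at x within {a..b})"
      by (rule H(1)[OF d eq i(2)])
    moreover have "(hyp_op a b 0 ^^ 2) s x = g 4 x - 2 * 0\<^sup>2 * g 2 x + 0 ^ 4 * g 0 x"
      by (rule H(2)[OF d eq i(2)])
    ultimately show ?thesis by (simp add: g4)
  qed
  then show "s \<in> polyhyp_splines a b N X 0"
    using s unfolding cubic_splines_def polyhyp_splines_def by blast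
next
  fix s assume s: "s \<in> polyhyp_splines a b N X 0"
  then obtain z where z: "s = (\<lambda>x\<in>{a..b}. comb 0 z 0 x)"
    unfolding polyhyp_splines_iff by blast
  have "\<exists>p. degree p \<le> 3 \<and> (\<forall>x\<in>{X (j - 1)..X j}. s x = poly p x)" if j: "j \<in> {1..N}" for j
  proof -
    define i where "i = j - 1"
    have i: "i < N" "Suc i = j" using j by (auto simp: i_def)
    obtain P where P: "\<And>k. k < N + 3 \<Longrightarrow> degree (P k) \<le> 3"
      "\<And>k x. k < N + 3 \<Longrightarrow> x \<in> {X i..X (Suc i)} \<Longrightarrow> bas 0 k 0 x = poly (P k) x"
      using bas_0_poly[OF _ i(1)] by metis
    let ?p = "\<Sum>k<N + 3. Polynomial.smult (z k) (P k)"
    have "degree ?p \<le> 3"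
      using P(1) degree_smult_le by (intro degree_sum_le) (auto intro: order_trans)
    moreover have "s x = poly ?p x" if x: "x \<in> {X (j - 1)..X j}" for x
    proof -
      have xi: "x \<in> {X i..X (Suc i)}" using x unfolding i(2) i_def[symmetric] .
      then have "x \<in> {a..b}" using X_mem[of i] X_mem[of "Suc i"] i j by auto
      then have "s x = comb 0 z 0 x" by (simp add: z)
      also have "\<dots> = poly ?p x"
        unfolding comb_def poly_sum poly_smult using P(2) xi by (intro sum.cong) simp_all
      finally show ?thesis .
    qed
    ultimately show ?thesis
      by (intro exI[of _ ?p] conjI ballI)
  qed
  then show "s \<in> cubic_splines a b N X"
    using s unfolding cubic_splines_def polyhyp_splines_def by blast
qed

text \<open>At a knot the formula takes the value from the right, so the third derivative of a cubic
  spline on a segment equals its value at the left knot.\<close>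

lemma bas_0_3: "bas 0 k 3 x = (if k < 3 then 0 else of_bool (X (k - 3) \<le> x))"
  by (simp add: bas_def hyp_sol_def sum_lessThan_4 eval_nat_numeral jet_shift_def phi_def)

lemma bas_0_2: "k < 3 \<Longrightarrow> bas 0 k 2 x = of_bool (k = 2)"
  by (auto simp: bas_def hyp_sol_def sum_lessThan_4 eval_nat_numeral jet_shift_def phi_def)

lemma bas_0_0: "k < 3 \<Longrightarrow> bas 0 k 0 x = (x - a) ^ k / fact k"
  by (simp add: bas_def hyp_sol_unit phi_def)

text \<open>Where \<open>s\<close> is cubic, \<open>(s'' s' - s''' s)' = (s'')\<^sup>2\<close>. At the knots \<open>s = 0\<close>, so the jumps of
  \<open>s'''\<close> do not matter there, and the end conditions kill \<open>s'' s'\<close> at \<open>a\<close> and \<open>b\<close>.\<close>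

lemma cubic_kernel_trivial:
  assumes knots: "\<And>i. i \<le> N \<Longrightarrow> comb 0 z 0 (X i) = 0"
    and ends: "n = 1 \<or> n = 2" "comb 0 z n a = 0" "comb 0 z n b = 0"
    and k: "k < N + 3"
  shows "z k = 0"
proof -
  define S where "S = comb 0 z"
  have S3: "S 3 x = S 3 (X i)" if "i < N" "x \<in> {X i..<X (Suc i)}" for i x
  proof -
    have "bas 0 k 3 x = bas 0 k 3 (X i)" if "k < N + 3" for k
    proof -
      have "k - 3 \<le> N" using that by linarith
      then show ?thesis
        using X_le[of "k - 3" i] X_le[of "Suc i" "k - 3"] \<open>i < N\<close> \<open>x \<in> _\<close>
        by (cases "k - 3 \<le> i") (auto simp: bas_0_3)
    qed
    then show ?thesis unfolding S_def comb_def by (intro sum.cong) simp_all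
  qed
  \<comment> \<open>Freezing the third derivative at \<open>X i\<close> keeps \<open>E i\<close>
    continuous up to the right end of the segment, where \<open>S 3\<close> may jump.\<close>
  define E where "E i x = S 2 x * S 1 x - S 3 (X i) * S 0 x" for i x
  define Q where "Q i = S 2 (X i) * S 1 (X i)" for i
  have EQ: "E i (X i) = Q i" "E i (X (Suc i)) = Q (Suc i)" if "i < N" for i
    using knots[of i] knots[of "Suc i"] that by (simp_all add: E_def Q_def S_def)
  have Sd: "(S m has_real_derivative S (Suc m) x) (at x)" if "m < 2 \<or> x \<in> off_knots" for m x
    unfolding S_def by (rule comb_deriv[OF that])
  have S2d: "(S 2 has_real_derivative S 3 (X i)) (at x)" if "i < N" "x \<in> {X i<..<X (Suc i)}" for i x
    using Sd[of 2 x] segment_off_knots[OF that] S3[of i x] that by (simp add: eval_nat_numeral)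
  have Ed: "(E i has_real_derivative (S 2 x)\<^sup>2) (at x)" if "i < N" "x \<in> {X i<..<X (Suc i)}" for i x
  proof -
    have "(S 1 has_real_derivative S 2 x) (at x)" "(S 0 has_real_derivative S 1 x) (at x)"
      using Sd[of 1 x] Sd[of 0 x] by (simp_all add: numeral_2_eq_2)
    then have "(E i has_real_derivative
        (S 2 x * S 2 x + S 3 (X i) * S 1 x - S 3 (X i) * S 1 x)) (at x)"
      unfolding E_def by (intro DERIV_diff DERIV_mult' DERIV_cmult S2d[OF that])
    then show ?thesis by (simp add: power2_eq_square)
  qed
  have mono: "E i x \<le> E i y" if "i < N" "X i \<le> x" "x \<le> y" "y \<le> X (Suc i)" for i x y
  proof (rule DERIV_nonneg_imp_increasing_open[OF \<open>x \<le> y\<close>])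
    show "\<exists>D. (E i has_real_derivative D) (at t) \<and> 0 \<le> D" if "x < t" "t < y" for t
      using Ed[of i t] that \<open>i < N\<close> \<open>X i \<le> x\<close> \<open>y \<le> _\<close> by (intro exI[of _ "(S 2 t)\<^sup>2"]) simp
    show "continuous_on {x..y} (E i)"
      unfolding E_def S_def
      by (intro continuous_on_diff continuous_on_mult continuous_on_const comb_continuous) simp_all
  qed
  have Qmono: "i \<le> j \<Longrightarrow> j \<le> N \<Longrightarrow> Q i \<le> Q j" for i j
  proof (induction j)
    case (Suc j)
    show ?case
    proof (cases "i = Suc j")
      case False
      then have "Q i \<le> Q j" using Suc by simp
      also have "Q j \<le> Q (Suc j)"
        using mono[of j "X j" "X (Suc j)"] EQ[of j] X_le[of j "Suc j"] Suc.prems by simp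
      finally show ?thesis .
    qed simp
  qed simp
  \<comment> \<open>For n = 1 the factor \<open>S 1\<close> vanishes at the ends, for n = 2 the
    factor \<open>S 2\<close>. Being monotone, \<open>Q\<close> is then zero throughout.\<close>
  have "Q 0 = 0" "Q N = 0"
    using ends X0 XN by (auto simp: Q_def S_def)
  then have Q: "Q i = 0" if "i \<le> N" for i
    using Qmono[of 0 i] Qmono[of i N] that by simp
  \<comment> \<open>\<open>E i\<close> is monotone between two zero values, hence constant; its
    derivative, the square of \<open>S 2\<close>, must vanish.\<close>
  have E: "E i x = 0" if "i < N" "x \<in> {X i<..<X (Suc i)}" for i x
    using mono[of i "X i" x] mono[of i x "X (Suc i)"] EQ[of i] Q[of i] Q[of "Suc i"] that by simp
  have S2: "S 2 x = 0" if "i < N" "x \<in> {X i<..<X (Suc i)}" for i x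
  proof -
    have "(E i has_real_derivative 0) (at x)"
      by (rule has_field_derivative_transform_within_open[where f="\<lambda>_. 0" and S="{X i<..<X (Suc i)}"])
        (use E that in simp_all)
    then show ?thesis using DERIV_unique Ed[OF that] by force
  qed
  have S3: "S 3 (X i) = 0" if "i < N" for i
  proof -
    have "X i < X (Suc i)" using X_less that by simp
    then obtain x where x: "x \<in> {X i<..<X (Suc i)}"
      using dense by auto
    have "(S 2 has_real_derivative 0) (at x)"
      by (rule has_field_derivative_transform_within_open[where f="\<lambda>_. 0" and S="{X i<..<X (Suc i)}"])
        (use S2[OF that] x in simp_all)
    then show ?thesis using DERIV_unique S2d[OF that x] by blast
  qed
  \<comment> \<open>\<open>S 3 (X j)\<close> is the sum of the coefficients of the truncated
    functions starting at or before \<open>X j\<close>, so strong induction isolates the last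
    one.\<close>
  have z3: "z (j + 3) = 0" if "j < N" for j
    using that
  proof (induction j rule: less_induct)
    case (less j)
    have "z k * bas 0 k 3 (X j) = (if k = j + 3 then z k else 0)" if "k < N + 3" for k
    proof -
      consider "k < 3" | "3 \<le> k" "k - 3 < j" | "k = j + 3" | "j < k - 3" by linarith
      then show ?thesis
      proof cases
        case 2
        then show ?thesis using less.IH[of "k - 3"] less.prems by simp
      next
        case 4
        have "X j < X (k - 3)" by (rule X_less) (use 4 that in linarith)+
        then show ?thesis using 4 by (simp add: bas_0_3)
      qed (simp_all add: bas_0_3)
    qed
    then have "S 3 (X j) = (\<Sum>k<N + 3. if k = j + 3 then z k else 0)"
      unfolding S_def comb_def by (intro sum.cong) simp_all
    then show ?case using S3[OF less.prems] less.prems by (simp add: sum.delta)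
  qed
  have comb3: "S m x = z 0 * bas 0 0 m x + z 1 * bas 0 1 m x + z 2 * bas 0 2 m x" for m x
  proof -
    have "z k = 0" if "k \<in> {..<N + 3} - {..<3}" for k
      using z3[of "k - 3"] that by (simp add: less_diff_conv2)
    then have "S m x = (\<Sum>k<3. z k * bas 0 k m x)"
      unfolding S_def comb_def by (intro sum.mono_neutral_right) simp_all
    then show ?thesis by (simp add: eval_nat_numeral)
  qed
  have "X 0 < X (Suc 0)" using X_less N by simp
  then obtain x where x: "x \<in> {X 0<..<X (Suc 0)}"
    using dense by auto
  \<comment> \<open>Only a parabola about \<open>a\<close> is left: its second derivative vanishes
    inside the first segment, and its zeros at \<open>X 0\<close> and \<open>X 1\<close> remove the
    rest.\<close>
  have z2: "z 2 = 0" using S2[of 0 x] x comb3[of 2 x] N by (simp add: bas_0_2)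
  have z0: "z 0 = 0" using knots[of 0] comb3[of 0 "X 0"] X0 z2 by (simp add: bas_0_0 S_def)
  have z1: "z 1 = 0"
    using knots[of 1] comb3[of 0 "X 1"] X_less[of 0 1] X0 z0 z2 N by (simp add: bas_0_0 S_def)
  have "k = 0 \<or> k = 1 \<or> k = 2 \<or> (\<exists>j<N. k = j + 3)"
    using k less_imp_add_positive by (cases "k < 3") (auto intro!: exI[of _ "k - 3"])
  then show ?thesis using z0 z1 z2 z3 by blast
qed

end

section \<open>Weighted splines and the limit\<close>

text \<open>\<open>W m\<close> is the \<open>m\<close>-th derivative of the factor by which polyhyperbolic splines are multiplied:
  \<open>1\<close>, or \<open>sech (\<alpha> x)\<close> for the second family.\<close>

definition weight :: "(nat \<Rightarrow> real \<Rightarrow> real) \<Rightarrow> bool" where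
  "weight W \<longleftrightarrow> (\<forall>m<2. \<forall>x. (W m has_real_derivative W (Suc m) x) (at x)) \<and> continuous_on UNIV (W 2)"

context knots
begin

text \<open>Leibniz rule for the product of the weight and a basis function; the last branch, the
  second derivative, is taken for every m from 2 on.\<close>

definition gbas :: "(nat \<Rightarrow> real \<Rightarrow> real) \<Rightarrow> real \<Rightarrow> nat \<Rightarrow> nat \<Rightarrow> real \<Rightarrow> real" where
  "gbas W \<alpha> k m x =
     (if m = 0 then W 0 x * bas \<alpha> k 0 x
      else if m = 1 then W 1 x * bas \<alpha> k 0 x + W 0 x * bas \<alpha> k 1 x
      else W 2 x * bas \<alpha> k 0 x + 2 * W 1 x * bas \<alpha> k 1 x + W 0 x * bas \<alpha> k 2 x)"

definition gcomb :: "(nat \<Rightarrow> real \<Rightarrow> real) \<Rightarrow> real \<Rightarrow> (nat \<Rightarrow> real) \<Rightarrow> nat \<Rightarrow> real \<Rightarrow> real" where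
  "gcomb W \<alpha> z m x = (\<Sum>k<N + 3. z k * gbas W \<alpha> k m x)"

definition wsplines :: "(nat \<Rightarrow> real \<Rightarrow> real) \<Rightarrow> real \<Rightarrow> (real \<Rightarrow> real) set" where
  "wsplines W \<alpha> = (\<lambda>u. \<lambda>x\<in>{a..b}. W 0 x * u x) ` polyhyp_splines a b N X \<alpha>"

lemma gbas_deriv:
  assumes "weight W" "m < 2" "k < N + 3"
  shows "(gbas W \<alpha> k m has_real_derivative gbas W \<alpha> k (Suc m) x) (at x)"
proof -
  have W: "(W 0 has_real_derivative W 1 x) (at x)" "(W 1 has_real_derivative W 2 x) (at x)"
    using assms(1) unfolding weight_def by (auto simp: numeral_2_eq_2)
  have B: "(bas \<alpha> k 0 has_real_derivative bas \<alpha> k 1 x) (at x)"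
    "(bas \<alpha> k 1 has_real_derivative bas \<alpha> k 2 x) (at x)"
    using bas_deriv[of 0 x k \<alpha>] bas_deriv[of 1 x k \<alpha>] assms(3) by (simp_all add: numeral_2_eq_2)
  have "m = 0 \<or> m = 1" using assms(2) by auto
  then show ?thesis
  proof
    assume m: "m = 0"
    show ?thesis
      unfolding gbas_def[abs_def] m
      by (rule DERIV_cong, simp, (rule W B DERIV_mult' DERIV_add)+) simp
  next
    assume m: "m = 1"
    show ?thesis
      unfolding gbas_def[abs_def] m
      by (rule DERIV_cong, simp, (rule W[unfolded One_nat_def] B[unfolded One_nat_def] W B DERIV_mult' DERIV_add)+)
        (simp add: algebra_simps)
  qed
qed

lemma gcomb_deriv:
  "weight W \<Longrightarrow> m < 2 \<Longrightarrow> (gcomb W \<alpha> z m has_real_derivative gcomb W \<alpha> z (Suc m) x) (at x)"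
  unfolding gcomb_def[abs_def] by (intro DERIV_sum DERIV_cmult gbas_deriv) auto

lemma gcomb_2_continuous:
  assumes "weight W"
  shows "continuous_on S (gcomb W \<alpha> z 2)"
proof -
  have d: "(W 0 has_real_derivative W 1 x) (at x)" "(W 1 has_real_derivative W 2 x) (at x)" for x
    using assms unfolding weight_def by (auto simp: numeral_2_eq_2)
  have c: "continuous_on S (W 0)" "continuous_on S (W 1)"
    using d by (auto intro!: DERIV_continuous_on intro: has_field_derivative_at_within)
  have c2: "continuous_on S (W 2)"
    using assms unfolding weight_def by (auto intro: continuous_on_subset)
  have "continuous_on S (\<lambda>x. z k * gbas W \<alpha> k 2 x)" if "k < N + 3" for k
    unfolding gbas_def
    by simp (intro continuous_on_add continuous_on_mult continuous_on_const c[unfolded One_nat_def] c2 c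
        bas_continuous[OF _ that]; simp)
  then show ?thesis
    unfolding gcomb_def[abs_def] by (intro continuous_on_sum) simp
qed

lemma wsplines_iff: "t \<in> wsplines W \<alpha> \<longleftrightarrow> (\<exists>z. t = (\<lambda>x\<in>{a..b}. gcomb W \<alpha> z 0 x))"
proof -
  have eq: "(\<lambda>x\<in>{a..b}. W 0 x * (\<lambda>x\<in>{a..b}. comb \<alpha> z 0 x) x) = (\<lambda>x\<in>{a..b}. gcomb W \<alpha> z 0 x)" for z
    by (rule restrict_ext) (simp add: gcomb_def comb_def gbas_def sum_distrib_left mult.left_commute)
  have "polyhyp_splines a b N X \<alpha> = range (\<lambda>z. \<lambda>x\<in>{a..b}. comb \<alpha> z 0 x)"
    using polyhyp_splines_iff by blast
  then show ?thesis
    unfolding wsplines_def by (simp only: image_image eq) blast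
qed

text \<open>Equations \<open>0, ..., N\<close> are the interpolation conditions, and \<open>N + 1\<close>, \<open>N + 2\<close> the end conditions
  at \<open>a\<close> and \<open>b\<close>.\<close>

definition sys_row :: "(nat \<Rightarrow> real \<Rightarrow> real) \<Rightarrow> real \<Rightarrow> end_type \<Rightarrow> nat \<Rightarrow> nat \<Rightarrow> real" where
  "sys_row W \<alpha> e i k =
     (if i \<le> N then gbas W \<alpha> k 0 (X i)
      else gbas W \<alpha> k (if e = Type_I then 1 else 2) (if i = N + 1 then a else b))"

text \<open>Type II shares its rows with Type III and differs only in the zero end data.\<close>

definition sys_rhs :: "end_type \<Rightarrow> (nat \<Rightarrow> real) \<Rightarrow> real \<Rightarrow> real \<Rightarrow> nat \<Rightarrow> real" where
  "sys_rhs e y c d i =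
     (if i \<le> N then y i else if e = Type_II then 0 else if i = N + 1 then c else d)"

lemma interpolates_iff:
  assumes "weight W"
  shows "interpolates a b N X e y c d (\<lambda>x\<in>{a..b}. gcomb W \<alpha> z 0 x) \<longleftrightarrow>
    (\<forall>i<N + 3. (\<Sum>k<N + 3. sys_row W \<alpha> e i k * z k) = sys_rhs e y c d i)"
proof -
  let ?u = "\<lambda>x\<in>{a..b}. gcomb W \<alpha> z 0 x"
  have d: "(gcomb W \<alpha> z m has_real_derivative gcomb W \<alpha> z (Suc m) x) (at x within {a..b})" if "m < 2" for m x
    by (rule has_field_derivative_at_within, rule gcomb_deriv) (use assms that in auto)
  have ends: "a \<in> {a..b}" "b \<in> {a..b}" using ab by auto
  have eq: "?u x = gcomb W \<alpha> z 0 x" if "x \<in> {a..b}" for x using that by simp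
  note D = C2_ivlI(2,3)[OF ab restrict_extensional, where g="gcomb W \<alpha> z", OF eq d gcomb_2_continuous[OF assms]]
  have D1: "ivl_deriv a b ?u x = gcomb W \<alpha> z 1 x" if "x \<in> {a..b}" for x
    by (rule D(1)) (use that in auto)
  have D2: "ivl_deriv a b (ivl_deriv a b ?u) x = gcomb W \<alpha> z 2 x" if "x \<in> {a..b}" for x
    by (rule D(2)) (use that in auto)
  have r: "(\<Sum>k<N + 3. sys_row W \<alpha> e i k * z k) =
      gcomb W \<alpha> z (if i \<le> N then 0 else if e = Type_I then 1 else 2)
        (if i \<le> N then X i else if i = N + 1 then a else b)" for i
    unfolding gcomb_def sys_row_def by (intro sum.cong) simp_all
  have split: "(\<forall>i<N + 3. P i) \<longleftrightarrow> (\<forall>i\<le>N. P i) \<and> P (N + 1) \<and> P (N + 2)" for P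
  proof -
    have "i < N + 3 \<longleftrightarrow> i \<le> N \<or> i = N + 1 \<or> i = N + 2" for i by linarith
    then show ?thesis by metis
  qed
  have vals: "?u (X i) = gcomb W \<alpha> z 0 (X i)" if "i \<le> N" for i
    by (rule eq[OF X_mem[OF that]])
  show ?thesis
    unfolding interpolates_def split r
    by (cases e) (simp_all add: vals D1[OF ends(1)] D1[OF ends(2)] D2[OF ends(1)] D2[OF ends(2)] sys_rhs_def
        del: restrict_apply)
qed

text \<open>The equivalence yields existence, uniqueness and the value of the definite description
  in one statement, with a formula that passes to the limit.\<close>

lemma interpolant_unique:
  assumes W: "weight W"
    and C: "\<forall>r z. (\<forall>i<N + 3. (\<Sum>k<N + 3. sys_row W \<alpha> e i k * z k) = r i) \<longleftrightarrow>
      (\<forall>k<N + 3. z k = (\<Sum>i<N + 3. C k i * r i))"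
  shows "t \<in> wsplines W \<alpha> \<and> interpolates a b N X e y c d t \<longleftrightarrow>
    t = (\<lambda>x\<in>{a..b}. gcomb W \<alpha> (\<lambda>k. \<Sum>i<N + 3. C k i * sys_rhs e y c d i) 0 x)"
    (is "_ \<longleftrightarrow> t = ?t")
proof
  assume t: "t \<in> wsplines W \<alpha> \<and> interpolates a b N X e y c d t"
  then obtain z where z: "t = (\<lambda>x\<in>{a..b}. gcomb W \<alpha> z 0 x)"
    unfolding wsplines_iff by blast
  have "\<forall>k<N + 3. z k = (\<Sum>i<N + 3. C k i * sys_rhs e y c d i)"
    using t C interpolates_iff[OF W] unfolding z by blast
  then have "gcomb W \<alpha> z 0 x = gcomb W \<alpha> (\<lambda>k. \<Sum>i<N + 3. C k i * sys_rhs e y c d i) 0 x" for x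
    unfolding gcomb_def by (intro sum.cong) simp_all
  then show "t = ?t" unfolding z by (intro restrict_ext)
next
  assume t: "t = ?t"
  have "interpolates a b N X e y c d ?t"
    unfolding interpolates_iff[OF W] C[rule_format] by blast
  moreover have "?t \<in> wsplines W \<alpha>" unfolding wsplines_iff by blast
  ultimately show "t \<in> wsplines W \<alpha> \<and> interpolates a b N X e y c d t" unfolding t by blast
qed

text \<open>It describes the first family itself and is also the limit of the \<open>sech\<close>
  weights.\<close>

abbreviation unit_weight :: "nat \<Rightarrow> real \<Rightarrow> real" where
  "unit_weight \<equiv> \<lambda>m x. of_bool (m = 0)"

lemma weight_unit: "weight unit_weight"
  unfolding weight_def by (auto simp: less_2_cases_iff)

lemma wsplines_unit: "wsplines unit_weight \<alpha> = polyhyp_splines a b N X \<alpha>"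
proof -
  have "(\<lambda>x\<in>{a..b}. of_bool ((0::nat) = 0) * u x) = u" if "u \<in> polyhyp_splines a b N X \<alpha>" for u
    using that by (auto simp: polyhyp_splines_def C2_ivl_def intro!: extensional_restrict)
  then show ?thesis unfolding wsplines_def by (simp add: image_cong[OF refl, of _ _ id, simplified])
qed

lemma gbas_unit: "m < 3 \<Longrightarrow> gbas unit_weight \<alpha> k m x = bas \<alpha> k m x"
  using less_4_cases[of m] by (auto simp: gbas_def)

text \<open>A kernel vector of the limit matrix is a cubic spline with zero data: Type I gives zero
  first derivatives at the ends, the other types zero second derivatives.\<close>

lemma sys_row_kernel:
  assumes "\<And>i. i < N + 3 \<Longrightarrow> (\<Sum>k<N + 3. sys_row unit_weight 0 e i k * z k) = 0" "k < N + 3"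
  shows "z k = 0"
proof (rule cubic_kernel_trivial[OF _ _ _ _ assms(2)])
  let ?n = "if e = Type_I then 1 else (2::nat)"
  have sys_row: "(\<Sum>k<N + 3. sys_row unit_weight 0 e i k * z k) =
      comb 0 z (if i \<le> N then 0 else ?n) (if i \<le> N then X i else if i = N + 1 then a else b)" for i
    unfolding comb_def sys_row_def by (intro sum.cong) (simp_all add: gbas_unit)
  show "comb 0 z 0 (X i) = 0" if "i \<le> N" for i
    using assms(1)[of i] that unfolding sys_row by simp
  show "?n = 1 \<or> ?n = 2" by simp
  show "comb 0 z ?n a = 0" using assms(1)[of "N + 1"] unfolding sys_row by simp
  show "comb 0 z ?n b = 0" using assms(1)[of "N + 2"] unfolding sys_row by simp
qed

lemma gbas_tendsto:
  assumes "\<And>m x. m < 3 \<Longrightarrow> ((\<lambda>\<alpha>. W \<alpha> m x) \<longlongrightarrow> unit_weight m x) (at_right 0)"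
    and "x \<in> {a..b}"
  shows "((\<lambda>\<alpha>. gbas (W \<alpha>) \<alpha> k m x) \<longlongrightarrow> gbas unit_weight 0 k m x) (at_right 0)"
proof -
  note W = assms(1)[of 0] assms(1)[of 1] assms(1)[of 2]
  note B = bas_tendsto[OF assms(2)]
  have "((\<lambda>\<alpha>. W \<alpha> 0 x * bas \<alpha> k 0 x) \<longlongrightarrow> unit_weight 0 x * bas 0 k 0 x) (at_right 0)"
    by (intro tendsto_mult W B) simp
  moreover have "((\<lambda>\<alpha>. W \<alpha> 1 x * bas \<alpha> k 0 x + W \<alpha> 0 x * bas \<alpha> k 1 x)
      \<longlongrightarrow> unit_weight 1 x * bas 0 k 0 x + unit_weight 0 x * bas 0 k 1 x) (at_right 0)"
    by (intro tendsto_add tendsto_mult W B) simp_all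
  moreover have "((\<lambda>\<alpha>. W \<alpha> 2 x * bas \<alpha> k 0 x + 2 * W \<alpha> 1 x * bas \<alpha> k 1 x + W \<alpha> 0 x * bas \<alpha> k 2 x)
      \<longlongrightarrow> unit_weight 2 x * bas 0 k 0 x + 2 * unit_weight 1 x * bas 0 k 1 x
        + unit_weight 0 x * bas 0 k 2 x) (at_right 0)"
    by (intro tendsto_add tendsto_mult tendsto_const W B) simp_all
  ultimately show ?thesis
    unfolding gbas_def by (cases "m = 0"; cases "m = 1") simp_all
qed

text \<open>For any weights tending to the unit weight the matrices tend to the one cubic matrix,
  whose invertibility settles both claims.\<close>

lemma wsplines_limit:
  assumes W: "\<And>\<alpha>. weight (W \<alpha>)"
    and lim: "\<And>m x. m < 3 \<Longrightarrow> ((\<lambda>\<alpha>. W \<alpha> m x) \<longlongrightarrow> unit_weight m x) (at_right 0)"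
  shows "\<forall>\<^sub>F \<alpha> in at_right 0. \<forall>y c d.
      \<exists>!t. t \<in> wsplines (W \<alpha>) \<alpha> \<and> interpolates a b N X e y c d t"
    and "x \<in> {a..b} \<Longrightarrow>
      ((\<lambda>\<alpha>. (THE t. t \<in> wsplines (W \<alpha>) \<alpha> \<and> interpolates a b N X e y c d t) x)
        \<longlongrightarrow> cubic_interpolant a b N X e y c d x) (at_right 0)"
proof -
  have rlim: "((\<lambda>\<alpha>. sys_row (W \<alpha>) \<alpha> e i k) \<longlongrightarrow> sys_row unit_weight 0 e i k) (at_right 0)" for i k
    unfolding sys_row_def using X_mem[of i] ab gbas_tendsto[of W, OF lim] by simp
  obtain C C0 where C: "\<And>i j. i < N + 3 \<Longrightarrow> j < N + 3 \<Longrightarrow> ((\<lambda>\<alpha>. C \<alpha> i j) \<longlongrightarrow> C0 i j) (at_right 0)"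
    and ev: "\<forall>\<^sub>F \<alpha> in at_right 0. \<forall>r z.
      (\<forall>i<N + 3. (\<Sum>k<N + 3. sys_row (W \<alpha>) \<alpha> e i k * z k) = r i) \<longleftrightarrow>
      (\<forall>k<N + 3. z k = (\<Sum>i<N + 3. C \<alpha> k i * r i))"
    and C0: "\<forall>r z. (\<forall>i<N + 3. (\<Sum>k<N + 3. sys_row unit_weight 0 e i k * z k) = r i) \<longleftrightarrow>
      (\<forall>k<N + 3. z k = (\<Sum>i<N + 3. C0 k i * r i))"
  proof (rule linear_system_perturb[where n="N + 3" and A="\<lambda>\<alpha>. sys_row (W \<alpha>) \<alpha> e"
        and L="sys_row unit_weight 0 e" and F="at_right 0"])
    show "z k = 0"
      if "\<And>i. i < N + 3 \<Longrightarrow> (\<Sum>k<N + 3. sys_row unit_weight 0 e i k * z k) = 0" "k < N + 3" for z k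
      by (rule sys_row_kernel[OF that])
  qed (use rlim that in blast)+
  show "\<forall>\<^sub>F \<alpha> in at_right 0. \<forall>y c d.
      \<exists>!t. t \<in> wsplines (W \<alpha>) \<alpha> \<and> interpolates a b N X e y c d t"
  proof (rule eventually_mono[OF ev])
    fix \<alpha>
    assume "\<forall>r z. (\<forall>i<N + 3. (\<Sum>k<N + 3. sys_row (W \<alpha>) \<alpha> e i k * z k) = r i) \<longleftrightarrow>
      (\<forall>k<N + 3. z k = (\<Sum>i<N + 3. C \<alpha> k i * r i))"
    from interpolant_unique[OF W this]
    show "\<forall>y c d. \<exists>!t. t \<in> wsplines (W \<alpha>) \<alpha> \<and> interpolates a b N X e y c d t"
      by simp
  qed
  assume x: "x \<in> {a..b}"
  \<comment> \<open>The target is itself the unit-weight interpolant at \<alpha> = 0, so the same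
    solution formula applies to it with \<open>C0\<close>.\<close>
  have cubic: "cubic_interpolant a b N X e y c d x =
      gcomb unit_weight 0 (\<lambda>k. \<Sum>i<N + 3. C0 k i * sys_rhs e y c d i) 0 x"
    unfolding cubic_interpolant_def cubic_splines_eq wsplines_unit[symmetric]
      interpolant_unique[OF weight_unit C0] using x by simp
  have "((\<lambda>\<alpha>. gcomb (W \<alpha>) \<alpha> (\<lambda>k. \<Sum>i<N + 3. C \<alpha> k i * sys_rhs e y c d i) 0 x)
      \<longlongrightarrow> gcomb unit_weight 0 (\<lambda>k. \<Sum>i<N + 3. C0 k i * sys_rhs e y c d i) 0 x) (at_right 0)"
    unfolding gcomb_def
    by (intro tendsto_sum tendsto_mult tendsto_const C gbas_tendsto[of W, OF lim x]) simp_all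
  then show "((\<lambda>\<alpha>. (THE t. t \<in> wsplines (W \<alpha>) \<alpha> \<and> interpolates a b N X e y c d t) x)
      \<longlongrightarrow> cubic_interpolant a b N X e y c d x) (at_right 0)"
    unfolding cubic
  \<comment> \<open>The formula with \<open>C \<alpha>\<close> is known to be the interpolant only
    for small \<alpha>, which suffices for the limit.\<close>
  proof (rule Lim_transform_eventually, intro eventually_mono[OF ev])
    fix \<alpha>
    assume "\<forall>r z. (\<forall>i<N + 3. (\<Sum>k<N + 3. sys_row (W \<alpha>) \<alpha> e i k * z k) = r i) \<longleftrightarrow>
      (\<forall>k<N + 3. z k = (\<Sum>i<N + 3. C \<alpha> k i * r i))"
    from interpolant_unique[OF W this]
    show "gcomb (W \<alpha>) \<alpha> (\<lambda>k. \<Sum>i<N + 3. C \<alpha> k i * sys_rhs e y c d i) 0 x =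
        (THE t. t \<in> wsplines (W \<alpha>) \<alpha> \<and> interpolates a b N X e y c d t) x"
      using x by simp
  qed
qed

end

section \<open>The \<open>sech\<close> factor and the final statement\<close>

definition sech_weight :: "real \<Rightarrow> nat \<Rightarrow> real \<Rightarrow> real" where
  "sech_weight \<alpha> m x =
     (if m = 0 then sech (\<alpha> * x)
      else if m = 1 then - \<alpha> * sinh (\<alpha> * x) / (cosh (\<alpha> * x))\<^sup>2
      else \<alpha>\<^sup>2 * (2 * (sinh (\<alpha> * x))\<^sup>2 / cosh (\<alpha> * x) ^ 3 - 1 / cosh (\<alpha> * x)))"

lemma weight_sech: "weight (sech_weight \<alpha>)"
proof -
  have nz: "cosh (\<alpha> * x) \<noteq> 0" for x
    using cosh_real_pos[of "\<alpha> * x"] by simp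
  have "((\<lambda>x. 1 / cosh (\<alpha> * x)) has_real_derivative - \<alpha> * sinh (\<alpha> * x) / (cosh (\<alpha> * x))\<^sup>2) (at x)" for x
    using nz by (auto intro!: derivative_eq_intros simp: power2_eq_square)
  moreover have "((\<lambda>x. - \<alpha> * sinh (\<alpha> * x) / (cosh (\<alpha> * x))\<^sup>2) has_real_derivative
     \<alpha>\<^sup>2 * (2 * (sinh (\<alpha> * x))\<^sup>2 / cosh (\<alpha> * x) ^ 3 - 1 / cosh (\<alpha> * x))) (at x)" for x
    using nz[of x] by (auto intro!: derivative_eq_intros simp: field_simps power2_eq_square power3_eq_cube)
  moreover have "continuous_on UNIV
     (\<lambda>x. \<alpha>\<^sup>2 * (2 * (sinh (\<alpha> * x))\<^sup>2 / cosh (\<alpha> * x) ^ 3 - 1 / cosh (\<alpha> * x)))"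
    using nz by (intro continuous_intros) auto
  ultimately show ?thesis
    unfolding weight_def sech_weight_def sech_def by (auto simp: less_2_cases_iff)
qed

text \<open>\<open>cosh\<close> is nonzero at 0, so each formula is continuous at \<alpha> = 0; the
  factors \<alpha> and \<alpha>^2 from the chain rule make both derivatives vanish in the
  limit.\<close>

lemma sech_weight_tendsto:
  "((\<lambda>\<alpha>. sech_weight \<alpha> m x) \<longlongrightarrow> of_bool (m = 0)) (at_right 0)"
  unfolding sech_weight_def sech_def
  by (cases "m = 0"; cases "m = 1") (auto intro!: tendsto_eq_intros)

theorem theorem1:
  fixes a b :: real and N :: nat and X :: "nat \<Rightarrow> real" and e :: end_type
  assumes "interval_partition a b N X"
  shows "(\<exists>\<alpha>\<^sub>0>0. \<forall>\<alpha>\<in>{0<..<\<alpha>\<^sub>0}. \<forall>(y :: nat \<Rightarrow> real) (c :: real) (d :: real).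
            (\<exists>!s. s \<in> polyhyp_splines a b N X \<alpha> \<and> interpolates a b N X e y c d s) \<and>
            (\<exists>!t. t \<in> sech_splines a b N X \<alpha> \<and> interpolates a b N X e y c d t)) \<and>
         (\<forall>(y :: nat \<Rightarrow> real) (c :: real) (d :: real). \<forall>x\<in>{a..b}.
            ((\<lambda>\<alpha>. polyhyp_interpolant a b N X e y c d \<alpha> x)
               \<longlongrightarrow> cubic_interpolant a b N X e y c d x) (at_right 0) \<and>
            ((\<lambda>\<alpha>. sech_interpolant a b N X e y c d \<alpha> x)
               \<longlongrightarrow> cubic_interpolant a b N X e y c d x) (at_right 0))"
proof -
  interpret knots a b N X using assms by unfold_locales
  have sech: "wsplines (sech_weight \<alpha>) \<alpha> = sech_splines a b N X \<alpha>" for \<alpha>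
    by (simp add: wsplines_def sech_splines_def sech_weight_def)
  note P = wsplines_limit[where W="\<lambda>_. unit_weight" and e=e, OF weight_unit tendsto_const,
      unfolded wsplines_unit, folded polyhyp_interpolant_def]
  note S = wsplines_limit[where W=sech_weight and e=e, OF weight_sech sech_weight_tendsto,
      unfolded sech, folded sech_interpolant_def]
  \<comment> \<open>Joining the two eventualities gives one bound for both families.\<close>
  from eventually_conj[OF P(1) S(1)] obtain \<alpha>\<^sub>0 where "\<alpha>\<^sub>0 > 0" and
    "\<forall>\<alpha>>0. \<alpha> < \<alpha>\<^sub>0 \<longrightarrow>
      (\<forall>y c d. \<exists>!s. s \<in> polyhyp_splines a b N X \<alpha> \<and> interpolates a b N X e y c d s) \<and>
      (\<forall>y c d. \<exists>!t. t \<in> sech_splines a b N X \<alpha> \<and> interpolates a b N X e y c d t)"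
    unfolding eventually_at_right_field by blast
  then have "\<exists>\<alpha>\<^sub>0>0. \<forall>\<alpha>\<in>{0<..<\<alpha>\<^sub>0}. \<forall>(y :: nat \<Rightarrow> real) (c :: real) (d :: real).
            (\<exists>!s. s \<in> polyhyp_splines a b N X \<alpha> \<and> interpolates a b N X e y c d s) \<and>
            (\<exists>!t. t \<in> sech_splines a b N X \<alpha> \<and> interpolates a b N X e y c d t)"
    by (intro exI[of _ \<alpha>\<^sub>0]) simp
  moreover have "\<forall>(y :: nat \<Rightarrow> real) (c :: real) (d :: real). \<forall>x\<in>{a..b}.
            ((\<lambda>\<alpha>. polyhyp_interpolant a b N X e y c d \<alpha> x)
               \<longlongrightarrow> cubic_interpolant a b N X e y c d x) (at_right 0) \<and>
            ((\<lambda>\<alpha>. sech_interpolant a b N X e y c d \<alpha> x)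
               \<longlongrightarrow> cubic_interpolant a b N X e y c d x) (at_right 0)"
    using P(2) S(2) by blast
  ultimately show ?thesis by blast
qed

end
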